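(* Assume (AD) and (AR) from the context, let $x^\dagger$ be the solution of the problem $$\text{minimize } \Big\{R(x)\ \Big|\ x\in\operatorname{argmin}_{x'\in X} D(Ax';\bar y)\Big\},$$ and assume that the qualification condition $\partial R(x^\dagger)\cap\operatorname{Im}A^*\neq\emptyset$ holds. Fix $\theta\in]0,+\infty[$, and suppose that for every $n\in\mathbb{N}$, $\lambda_n=\lambda_0/(n+1)^\beta$ for some $\lambda_0>0$ and some $\beta\in]p-1,+\infty[$. Fix the stepsize $\tau$ and the initial point $u_0\in Y$ of the (3-D) method. For $\delta\in]0,+\infty[$ and $\hat y\in Y$ a $(\delta,\theta)$-perturbation of $\bar y$ according to $D$, let $(\hat x_n,\hat w_n,\hat u_n)_{n\in\mathbb{N}}$ be the sequence generated by the (3-D) method with $y=\hat y$ and $\hat u_0=u_0$. Then there exists $t(\delta)\sim\delta^{-2/(3+2\beta\theta)}$ such that, for all $c\ge1$, the early stopping rule $n(\delta)=\lceil c\,t(\delta)\rceil$ verifies $$\|\hat x_{n(\delta)}-x^\dagger\|=O\Big(\delta^{\frac{1}{3+2\beta\theta}}\Big)\quad\text{when }\delta\to0 .$$ Here $t(\delta)\sim\delta^{-2/(3+2\beta\theta)}$ means that $t(\delta)\,\delta^{2/(3+2\beta\theta)}$ stays between two positive constants as $\delta\to0$; $t(\delta)$ depends on $\delta$ but not on the particular $\hat y$, and the constant in $O(\cdot)$ (which may depend on $c$) does not depend on $\delta$ or on $\hat y$.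
   Context: Notation. $\Gamma_0(H)$ is the set of proper, convex, lower semicontinuous functions from a Hilbert space $H$ to $]-\infty,+\infty]$; $f^*$ is the Fenchel conjugate of $f$; $f\in\Gamma_0(H)$ is $\sigma$-strongly convex ($\sigma>0$) if $f-\frac{\sigma}{2}\|\cdot\|^2\in\Gamma_0(H)$; $(f\# g)(x)=\inf_{x'}\{f(x')+g(x-x')\}$ is the infimal convolution; $\operatorname{prox}_f(x)=\operatorname{argmin}_{x'}\{f(x')+\frac12\|x'-x\|^2\}$. A function is coercive if it tends to $+\infty$ as $\|x\|\to+\infty$. Conditioning. Let $f\in\Gamma_0(H)$ have a unique minimizer $x_0$. A conditioning modulus for $f$ is a nonnegative even function $m\in\Gamma_0(\mathbb{R})$ such that $m(t)=0\Rightarrow t=0$ and $m(\|x-x_0\|)\le f(x)-f(x_0)$ for all $x\in H$. For $p\in[1,+\infty[$, $f$ is $p$-well conditioned with conditioning modulus $m$ if moreover there exist $\varepsilon,\gamma>0$ with $m(t)\ge\frac{\gamma}{p}|t|^p$ for all $t\in]-\varepsilon,\varepsilon[$. Setting. $X,Y$ are Hilbert spaces, $A:X\to Y$ is a bounded linear operator, $\bar y\in Y$, and there exists $\bar x\in X$ with $A\bar x=\bar y$. Assumption (AD). (AD1) $D:Y\times Y\to[0,+\infty]$ and, for all $(u,y)\in Y^2$, $D(u;y)=0\iff u=y$. (AD2) For every $y\in Y$, $D_y:=D(\cdot;y)$ decomposes as $D_y=\psi_y\#\phi_y$, where $\phi_y\in\Gamma_0(Y)$ and $\psi_y=J_y+\frac{\sigma_\psi}{2}\|\cdot\|^2$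 for some $J_y\in\Gamma_0(Y)$ and some $\sigma_\psi>0$ (independent of $y$). (AD3) $D(\cdot;\bar y)$ is coercive and $p$-well conditioned for some $p\in[1,+\infty[$, with conditioning modulus $\bar m$. Assumption (AR). (AR1) $R\in\Gamma_0(X)$ is $\sigma_R$-strongly convex with $\sigma_R>0$. (AR2) $\bar x\in\operatorname{dom}R$. (3-D) method with datum $y\in Y$. Let $(\lambda_n)_{n\in\mathbb{N}}$ be a sequence in $]0,+\infty[$ decreasing to $0$, $L=\|A\|^2/\sigma_R+\lambda_0/\sigma_\psi$, $\tau\in]0,1/L]$, $u_0\in Y$, and for all $n\in\mathbb{N}$ $$x_n=\nabla R^*(-A^*u_n),\quad w_{n+1}=u_n+\tau Ax_n-\tau\nabla\psi_y^*(\lambda_nu_n),\quad u_{n+1}=w_{n+1}-\tau\operatorname{prox}_{(\tau\lambda_n)^{-1}\phi_y}(\tau^{-1}w_{n+1}).$$ Perturbations. For $\delta>0$, $\theta\ge0$ and $(y,\hat y)\in Y^2$, $\hat y$ is a $(\delta,\theta)$-perturbation of $y$ according to $D$ if $$\sup_{u\in Y}\|\operatorname{prox}_{J_y/\sigma_\psi}(u)-\operatorname{prox}_{J_{\hat y}/\sigma_\psi}(u)\|\le\delta\quad\text{and}\quad(\forall\alpha>0)\ \sup_{u\in Y}\|\operatorname{prox}_{\alpha\phi_y}(u)-\operatorname{prox}_{\alpha\phi_{\hat y}}(u)\|\le\alpha^\theta\delta .$$ *)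

theory Defs
  imports "HOL-Analysis.Analysis"
begin

text \<open>
  Hilbert spaces are types of sort \<open>{real_inner, complete_space}\<close>; functions with values in
  \<open>]-\<infinity>,+\<infinity>]\<close> are \<open>ereal\<close>-valued functions that avoid \<open>-\<infinity>\<close>.
\<close>

(* For t in ]0,1[ and values different from -\<infinity> no indeterminate form occurs in the
   convexity inequality. *)
definition Gamma0 :: "('a::real_normed_vector \<Rightarrow> ereal) \<Rightarrow> bool" where
  "Gamma0 f \<longleftrightarrow>
     (\<forall>x. f x \<noteq> - \<infinity>) \<and> (\<exists>x. f x \<noteq> \<infinity>) \<and>
     (\<forall>x y t. 0 < t \<and> t < 1 \<longrightarrow>
        f ((1 - t) *\<^sub>R x + t *\<^sub>R y) \<le> ereal (1 - t) * f x + ereal t * f y) \<and>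
     (\<forall>x. f x \<le> Liminf (at x) f)"

definition edom :: "('a \<Rightarrow> ereal) \<Rightarrow> 'a set" where
  "edom f = {x. f x < \<infinity>}"

definition strongly_convex :: "real \<Rightarrow> ('a::real_normed_vector \<Rightarrow> ereal) \<Rightarrow> bool" where
  "strongly_convex \<sigma> f \<longleftrightarrow>
     Gamma0 f \<and> Gamma0 (\<lambda>x. f x - ereal (\<sigma> / 2 * (norm x)\<^sup>2))"

definition fenchel_conjugate :: "('a::real_inner \<Rightarrow> ereal) \<Rightarrow> 'a \<Rightarrow> ereal" where
  "fenchel_conjugate f u = (SUP x. ereal (x \<bullet> u) - f x)"

definition inf_convolution ::
    "('a::real_normed_vector \<Rightarrow> ereal) \<Rightarrow> ('a \<Rightarrow> ereal) \<Rightarrow> 'a \<Rightarrow> ereal" where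
  "inf_convolution f g x = (INF x'. f x' + g (x - x'))"

definition minimizer :: "('a \<Rightarrow> ereal) \<Rightarrow> 'a \<Rightarrow> bool" where
  "minimizer f x \<longleftrightarrow> is_arg_min f (\<lambda>_. True) x"

definition prox :: "('a::real_normed_vector \<Rightarrow> ereal) \<Rightarrow> 'a \<Rightarrow> 'a" where
  "prox f x = (THE p. minimizer (\<lambda>x'. f x' + ereal (1 / 2 * (norm (x' - x))\<^sup>2)) p)"

definition subdifferential :: "('a::real_inner \<Rightarrow> ereal) \<Rightarrow> 'a \<Rightarrow> 'a set" where
  "subdifferential f x = {v. \<forall>x'. f x + ereal ((x' - x) \<bullet> v) \<le> f x'}"

(* real_of_ereal sends \<plusminus>\<infinity> to 0, so finiteness near x has to be required explicitly. *)
definition grad :: "('a::real_inner \<Rightarrow> ereal) \<Rightarrow> 'a \<Rightarrow> 'a" where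
  "grad f x = (THE g. (\<forall>\<^sub>F z in nhds x. \<bar>f z\<bar> \<noteq> \<infinity>) \<and>
                      (GDERIV (\<lambda>z. real_of_ereal (f z)) x :> g))"

definition coercive :: "('a::real_normed_vector \<Rightarrow> ereal) \<Rightarrow> bool" where
  "coercive f \<longleftrightarrow> (f \<longlongrightarrow> \<infinity>) at_infinity"

definition conditioning_modulus ::
    "('a::real_normed_vector \<Rightarrow> ereal) \<Rightarrow> (real \<Rightarrow> ereal) \<Rightarrow> bool" where
  "conditioning_modulus f m \<longleftrightarrow>
     Gamma0 f \<and> (\<exists>!x0. minimizer f x0) \<and>
     Gamma0 m \<and> (\<forall>t. 0 \<le> m t) \<and> (\<forall>t. m (- t) = m t) \<and> (\<forall>t. m t = 0 \<longrightarrow> t = 0) \<and>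
     (\<forall>x0. minimizer f x0 \<longrightarrow> (\<forall>x. m (norm (x - x0)) \<le> f x - f x0))"

definition well_conditioned ::
    "real \<Rightarrow> ('a::real_normed_vector \<Rightarrow> ereal) \<Rightarrow> (real \<Rightarrow> ereal) \<Rightarrow> bool" where
  "well_conditioned p f m \<longleftrightarrow>
     conditioning_modulus f m \<and>
     (\<exists>\<epsilon>>0. \<exists>\<gamma>>0. \<forall>t\<in>{-\<epsilon><..<\<epsilon>}. ereal (\<gamma> / p * \<bar>t\<bar> powr p) \<le> m t)"

(* The functions psi and phi are those attached to the datum y. The value w 0 is not used by
   the method and is left unconstrained. *)
definition three_D_method ::
    "('a::real_inner \<Rightarrow> 'b::real_inner) \<Rightarrow> ('a \<Rightarrow> ereal) \<Rightarrow> ('b \<Rightarrow> ereal) \<Rightarrow> ('b \<Rightarrow> ereal) \<Rightarrow>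
     (nat \<Rightarrow> real) \<Rightarrow> real \<Rightarrow> 'b \<Rightarrow> (nat \<Rightarrow> 'a) \<Rightarrow> (nat \<Rightarrow> 'b) \<Rightarrow> (nat \<Rightarrow> 'b) \<Rightarrow> bool" where
  "three_D_method A R \<psi> \<phi> lam \<tau> u0 x w u \<longleftrightarrow>
     u 0 = u0 \<and>
     (\<forall>n. x n = grad (fenchel_conjugate R) (- adjoint A (u n)) \<and>
          w (Suc n) = u n + \<tau> *\<^sub>R A (x n) - \<tau> *\<^sub>R grad (fenchel_conjugate \<psi>) (lam n *\<^sub>R u n) \<and>
          u (Suc n) = w (Suc n) -
            \<tau> *\<^sub>R prox (\<lambda>v. ereal (inverse (\<tau> * lam n)) * \<phi> v) (inverse \<tau> *\<^sub>R w (Suc n)))"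

(* yh is a (\<delta>,\<theta>)-perturbation of y, relative to the decomposition data J, \<sigma>\<psi>, \<phi> of D. *)
definition perturbation ::
    "('b::real_normed_vector \<Rightarrow> 'b \<Rightarrow> ereal) \<Rightarrow> real \<Rightarrow> ('b \<Rightarrow> 'b \<Rightarrow> ereal) \<Rightarrow>
     real \<Rightarrow> real \<Rightarrow> 'b \<Rightarrow> 'b \<Rightarrow> bool" where
  "perturbation J \<sigma>\<psi> \<phi> \<delta> \<theta> y yh \<longleftrightarrow>
     (SUP u. ereal (norm (prox (\<lambda>v. J y v / ereal \<sigma>\<psi>) u - prox (\<lambda>v. J yh v / ereal \<sigma>\<psi>) u)))
       \<le> ereal \<delta> \<and>
     (\<forall>\<alpha>>0. (SUP u. ereal (norm (prox (\<lambda>v. ereal \<alpha> * \<phi> y v) u - prox (\<lambda>v. ereal \<alpha> * \<phi> yh v) u)))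
       \<le> ereal (\<alpha> powr \<theta> * \<delta>))"

end

theory Submission
  imports Defs
begin

text \<open>
  The (3-D) method is a forward-backward iteration on the dual of the regularised problem
  \<open>min R(x) + D(Ax; y) / \<lambda>\<close>, whose objective is
  \<open>d\<^sub>\<lambda>(u) = R*(- A* u) + D\<^sub>y*(\<lambda> u) / \<lambda>\<close>; the parameter \<open>\<lambda>\<^sub>n\<close> changes along the iteration.
  The error bound comes from comparing the noisy run with a run on the exact datum from the same
  initial point.

  Exact datum. Since \<open>D \<ge> 0\<close> vanishes at \<open>ybar\<close>, the functions \<open>d\<^sub>\<lambda>\<close> decrease, as
  \<open>\<lambda>\<close> decreases to 0, and dominate \<open>d(u) = R*(- A* u) + \<langle>ybar, u\<rangle>\<close>. The qualification condition
  provides a minimizer \<open>udag\<close> of \<open>d\<close>, and strong convexity of \<open>R\<close> bounds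
  \<open>\<parallel>x(u) - xdag\<parallel>\<^sup>2\<close> by the dual gap \<open>d(u) - min d\<close> (lemma \<open>dual_gap\<close>). The classical three-point
  inequality of a forward-backward step (\<open>dual_step\<close>), compared at \<open>udag\<close>, telescopes up to the
  errors \<open>d\<^sub>\<lambda>(udag) - d(udag)\<close> at \<open>\<lambda> = \<lambda>\<^sub>n\<close>. Conditioning of order \<open>p\<close> makes these of order
  \<open>\<lambda>\<^sub>n powr (1 / (p - 1))\<close> (\<open>well_conditioned_conjugate\<close>), which is summable because
  \<open>\<beta> > p - 1\<close>; for \<open>p = 1\<close> they vanish eventually. The gaps are thus summable, and they decrease, hence are \<open>O(1/n)\<close>; so the primal
  error is \<open>O(n powr (- 1/2))\<close> (\<open>exact_data_rate\<close>).

  Perturbed datum. A step with the exact datum is nonexpansive (\<open>step_nonexpansive\<close>), and by the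
  definition of a perturbation a step with \<open>yh\<close> differs from it by at most
  \<open>\<tau> \<delta> (1 + (\<tau> \<lambda>\<^sub>n) powr (- \<theta>))\<close>, so that after \<open>n\<close> steps the two runs differ by
  \<open>O(\<delta> n powr (1 + \<beta> \<theta>))\<close>. The choice \<open>n \<approx> \<delta> powr (- 2 / (3 + 2 \<beta> \<theta>))\<close> balances
  this with \<open>n powr (- 1/2)\<close>.

  All the points produced by the method are treated through one notion, strong subgradients: a proximal
  point, the gradient of a conjugate and the Riesz representer of a functional are all obtained by
  solving \<open>v - \<sigma> q \<in> \<partial>f(q)\<close>. The value of the dual objective after a step is then estimated
  directly on the conjugate of \<open>D = \<psi> # \<phi>\<close>, from the subgradients of \<open>\<psi>\<close> and \<open>\<phi>\<close> that the
  step provides (\<open>conjugate_step\<close>).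
\<close>

section \<open>Strong subgradients and proximal points\<close>

text \<open>
  For \<open>\<sigma> = 0\<close> this is the usual subdifferential at a point of the domain. For a
  \<open>\<sigma>\<close>-strongly convex \<open>F\<close> the quadratic term comes for free; it says that \<open>q\<close> is the gradient
  of the conjugate of \<open>F\<close> at \<open>v\<close>.
\<close>
definition strong_subgradient :: "real \<Rightarrow> ('a::real_inner \<Rightarrow> ereal) \<Rightarrow> 'a \<Rightarrow> 'a \<Rightarrow> bool" where
  "strong_subgradient \<sigma> F q v \<longleftrightarrow>
     \<bar>F q\<bar> \<noteq> \<infinity> \<and> (\<forall>x. F q + ereal ((x - q) \<bullet> v + \<sigma> / 2 * (norm (x - q))\<^sup>2) \<le> F x)"

lemma strong_subgradient_monotone:
  assumes "strong_subgradient \<sigma> F q v" and "strong_subgradient \<sigma> F q' v'"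
  shows "\<sigma> * (norm (q - q'))\<^sup>2 \<le> (q - q') \<bullet> (v - v')"
proof -
  obtain a b where ab: "F q = ereal a" "F q' = ereal b"
    using assms unfolding strong_subgradient_def by (metis ereal_real')
  have "F q + ereal ((q' - q) \<bullet> v + \<sigma> / 2 * (norm (q' - q))\<^sup>2) \<le> F q'"
    and "F q' + ereal ((q - q') \<bullet> v' + \<sigma> / 2 * (norm (q - q'))\<^sup>2) \<le> F q"
    using assms unfolding strong_subgradient_def by blast+
  then have "a + ((q' - q) \<bullet> v + \<sigma> / 2 * (norm (q - q'))\<^sup>2) \<le> b"
    and "b + ((q - q') \<bullet> v' + \<sigma> / 2 * (norm (q - q'))\<^sup>2) \<le> a"
    using ab by (auto simp: norm_minus_commute)
  then show ?thesis
    by (simp add: inner_diff_left inner_diff_right)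
qed

lemma Gamma0_eventually_greater:
  assumes "Gamma0 f" "y < f x"
  shows "\<forall>\<^sub>F z in nhds x. y < f z"
  using assms unfolding Gamma0_def eventually_nhds_conv_at le_Liminf_iff by blast

lemma Gamma0_convex:
  assumes "Gamma0 f" "0 < t" "t < 1"
  shows "f ((1 - t) *\<^sub>R x + t *\<^sub>R y) \<le> ereal (1 - t) * f x + ereal t * f y"
  using assms unfolding Gamma0_def by blast

text \<open>
  The function \<open>f\<close> is bounded below near a point \<open>x0\<close> of its domain by lower
  semicontinuity, and convexity along the ray from \<open>x0\<close> through \<open>x\<close> carries the bound outwards,
  where it deteriorates linearly.
\<close>
lemma Gamma0_linear_minorant:
  fixes f :: "'a::real_normed_vector \<Rightarrow> ereal"
  assumes f: "Gamma0 f"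
  obtains b a x0 where "b \<ge> 0" "\<forall>x. ereal (a - b * norm (x - x0)) \<le> f x"
proof -
  obtain x0 where "f x0 \<noteq> \<infinity>" "f x0 \<noteq> - \<infinity>"
    using f unfolding Gamma0_def by blast
  then obtain c where c: "f x0 = ereal c" by (cases "f x0") auto
  have "\<forall>\<^sub>F z in nhds x0. ereal (c - 1) < f z"
    by (rule Gamma0_eventually_greater[OF f]) (simp add: c)
  then obtain r where r: "r > 0" "\<And>z. dist z x0 < r \<Longrightarrow> ereal (c - 1) < f z"
    unfolding eventually_nhds_metric by blast
  have "ereal (c - 1 - 2 / r * norm (x - x0)) \<le> f x" for x
  proof (cases "norm (x - x0) < r")
    case True
    have "0 \<le> 2 / r * norm (x - x0)" using r(1) by simp
    then have "ereal (c - 1 - 2 / r * norm (x - x0)) \<le> ereal (c - 1)" by simp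
    also have "\<dots> \<le> f x" using r(2)[of x] True by (simp add: dist_norm)
    finally show ?thesis .
  next
    case False
    define d where "d = norm (x - x0)"
    define t where "t = r / (2 * d)"
    have d: "d \<ge> r" "d > 0" using False r(1) by (auto simp: d_def)
    have t: "0 < t" "t < 1" using d r(1) by (auto simp: t_def field_simps)
    define z where "z = (1 - t) *\<^sub>R x0 + t *\<^sub>R x"
    have "z - x0 = t *\<^sub>R (x - x0)" by (simp add: z_def algebra_simps)
    then have "norm (z - x0) = r / 2" using t d by (simp add: d_def[symmetric]) (simp add: t_def)
    then have "ereal (c - 1) < f z" using r by (auto simp: dist_norm)
    also have "\<dots> \<le> ereal (1 - t) * f x0 + ereal t * f x"
      unfolding z_def by (rule Gamma0_convex[OF f t])
    finally have *: "ereal (c - 1) < ereal (1 - t) * f x0 + ereal t * f x" .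
    show ?thesis
    proof (cases "f x")
      case (real b)
      have "c - 1 < (1 - t) * c + t * b" using * real c by simp
      then have "t * (c - b) < 1" by (simp add: algebra_simps)
      then have "c - 1 / t < b" using t by (simp add: field_simps)
      then show ?thesis using real by (simp add: t_def d_def)
    next
      case MInf
      then show ?thesis using f unfolding Gamma0_def by blast
    qed auto
  qed
  moreover have "2 / r \<ge> 0" using r by simp
  ultimately show ?thesis using that by blast
qed

text \<open>
  The linear minorant bounds the objective from below, and the parallelogram identity makes every
  minimizing sequence Cauchy; its limit is a minimizer by lower
  semicontinuity.
\<close>
lemma Gamma0_quadratic_minimizer:
  fixes f :: "'a::{real_inner,complete_space} \<Rightarrow> ereal"
  assumes f: "Gamma0 f" and s: "\<sigma> > 0"
  obtains q where "\<bar>f q\<bar> \<noteq> \<infinity>"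
    "\<And>x. f q + ereal (\<sigma> / 2 * (norm (q - c))\<^sup>2) \<le> f x + ereal (\<sigma> / 2 * (norm (x - c))\<^sup>2)"
proof -
  define H where "H x = f x + ereal (\<sigma> / 2 * (norm (x - c))\<^sup>2)" for x
  obtain b a x0 where b: "b \<ge> 0" and low: "\<forall>x. ereal (a - b * norm (x - x0)) \<le> f x"
    by (rule Gamma0_linear_minorant[OF f])
  \<comment> \<open>The minimum over \<open>s\<close> of \<open>a - b (s + norm (x0 - c)) + \<sigma>/2 s\<^sup>2\<close>.\<close>
  define B where "B = a - b * norm (x0 - c) - b\<^sup>2 / (2 * \<sigma>)"
  have B: "ereal B \<le> H x" for x
  proof -
    define s where "s = norm (x - c)"
    have "norm (x - x0) \<le> s + norm (x0 - c)"
      unfolding s_def using norm_triangle_ineq4[of "x - c" "x0 - c"] by simp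
    then have "b * norm (x - x0) \<le> b * (s + norm (x0 - c))" using b by (rule mult_left_mono)
    moreover have "0 \<le> (\<sigma> * s - b)\<^sup>2 / (2 * \<sigma>)" using s by simp
    moreover have "(\<sigma> * s - b)\<^sup>2 / (2 * \<sigma>) = \<sigma> / 2 * s\<^sup>2 - b * s + b\<^sup>2 / (2 * \<sigma>)"
      using \<open>\<sigma> > 0\<close> by (simp add: power2_diff power_mult_distrib diff_divide_distrib
        add_divide_distrib) (simp add: power2_eq_square)
    ultimately have "B \<le> a - b * norm (x - x0) + \<sigma> / 2 * s\<^sup>2"
      by (simp add: B_def algebra_simps)
    then have "ereal B \<le> ereal (a - b * norm (x - x0)) + ereal (\<sigma> / 2 * s\<^sup>2)" by simp
    also have "\<dots> \<le> H x" unfolding H_def s_def by (rule add_right_mono[OF low[rule_format]])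
    finally show ?thesis .
  qed
  define I where "I = (INF x. H x)"
  obtain xf where xf: "f xf \<noteq> \<infinity>" using f unfolding Gamma0_def by blast
  have "I \<le> H xf" unfolding I_def by (rule INF_lower) simp
  moreover have "H xf < \<infinity>" using xf by (auto simp: H_def)
  moreover have "ereal B \<le> I" unfolding I_def by (rule INF_greatest) (rule B)
  ultimately obtain i where i: "I = ereal i" by (cases I) auto
  have lb: "ereal i \<le> H x" for x unfolding i[symmetric] I_def by (rule INF_lower) simp
  have "\<exists>x. H x < ereal (i + 1 / real (Suc n))" for n
  proof -
    have "(INF x. H x) < ereal (i + 1 / real (Suc n))" unfolding I_def[symmetric] i by simp
    then show ?thesis unfolding INF_less_iff by blast
  qed
  then obtain X where X: "\<And>n. H (X n) < ereal (i + 1 / real (Suc n))" by metis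
  have "\<exists>r. f (X n) = ereal r" for n
    using X[of n] f unfolding Gamma0_def H_def by (cases "f (X n)") auto
  then obtain g where g: "\<And>n. f (X n) = ereal (g n)" by metis
  have Xr: "g n + \<sigma> / 2 * (norm (X n - c))\<^sup>2 < i + 1 / real (Suc n)" for n
    using X[of n] by (simp add: H_def g)
  have close: "\<sigma> / 8 * (norm (X n - X m))\<^sup>2 \<le> (1 / real (Suc n) + 1 / real (Suc m)) / 2" for n m
  proof -
    define z where "z = (1 - 1/2) *\<^sub>R X n + (1/2::real) *\<^sub>R X m"
    have "f z \<le> ereal (1 - 1/2) * f (X n) + ereal (1/2) * f (X m)"
      unfolding z_def by (rule Gamma0_convex[OF f]) auto
    then have "f z \<le> ereal ((g n + g m) / 2)" by (simp add: g add_divide_distrib)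
    moreover have "ereal i \<le> f z + ereal (\<sigma> / 2 * (norm (z - c))\<^sup>2)" using lb[of z] by (simp add: H_def)
    ultimately have "ereal i \<le> ereal ((g n + g m) / 2) + ereal (\<sigma> / 2 * (norm (z - c))\<^sup>2)"
      by (meson add_right_mono order_trans)
    then have 1: "i \<le> (g n + g m) / 2 + \<sigma> / 2 * (norm (z - c))\<^sup>2" by simp
    have zc: "z - c = (1/2) *\<^sub>R ((X n - c) + (X m - c))"
      by (simp add: z_def algebra_simps flip: scaleR_add_left)
    have z2: "(norm (z - c))\<^sup>2 = ((norm (X n - c))\<^sup>2 + (norm (X m - c))\<^sup>2) / 2
        - (norm (X n - X m))\<^sup>2 / 4"
      unfolding zc power2_norm_eq_inner
      by (simp add: inner_add_left inner_add_right inner_diff_left inner_diff_right inner_commute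
        field_simps)
    have "\<sigma> / 2 * (norm (z - c))\<^sup>2 = (\<sigma> / 2 * (norm (X n - c))\<^sup>2 + \<sigma> / 2 * (norm (X m - c))\<^sup>2) / 2
        - \<sigma> / 8 * (norm (X n - X m))\<^sup>2" unfolding z2 by (simp add: field_simps)
    moreover have "s \<le> (en + em) / 2"
      if "i \<le> (gn + gm) / 2 + z" "gn + xn < i + en" "gm + xm < i + em" "z = (xn + xm) / 2 - s"
      for s en em gn gm xn xm z :: real
      using that by (simp add: field_simps)
    ultimately show ?thesis using 1 Xr[of n] Xr[of m] by blast
  qed
  have "Cauchy X"
  proof (rule CauchyI)
    fix e :: real assume e: "e > 0"
    obtain N where N: "inverse (real (Suc N)) < \<sigma> / 8 * e\<^sup>2"
      using reals_Archimedean[of "\<sigma> / 8 * e\<^sup>2"] e s by auto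
    have "norm (X m - X n) < e" if "m \<ge> N" "n \<ge> N" for m n
    proof -
      have "1 / real (Suc m) \<le> 1 / real (Suc N)" "1 / real (Suc n) \<le> 1 / real (Suc N)"
        using that by (auto intro: divide_left_mono)
      then have "\<sigma> / 8 * (norm (X m - X n))\<^sup>2 < \<sigma> / 8 * e\<^sup>2"
        using close[of m n] N by (simp add: inverse_eq_divide)
      then have "(norm (X m - X n))\<^sup>2 < e\<^sup>2" using s by simp
      then show ?thesis using e by (simp add: power2_less_imp_less)
    qed
    then show "\<exists>M. \<forall>m\<ge>M. \<forall>n\<ge>M. norm (X m - X n) < e" by blast
  qed
  then obtain q where q: "X \<longlonglongrightarrow> q" using Cauchy_convergent_iff convergent_def by blast
  have lim: "(\<lambda>n. i + 1 / real (Suc n) - \<sigma> / 2 * (norm (X n - c))\<^sup>2) \<longlonglongrightarrow> i + 0 - \<sigma> / 2 * (norm (q - c))\<^sup>2"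
    by (intro tendsto_intros q LIMSEQ_Suc lim_1_over_n)
  \<comment> \<open>Any \<open>y < f q\<close> is below \<open>f (X n)\<close> for large \<open>n\<close>, hence below the limit of the upper bounds.\<close>
  have "f q \<le> ereal (i - \<sigma> / 2 * (norm (q - c))\<^sup>2)"
  proof (rule dense_le)
    fix y assume y: "y < f q"
    show "y \<le> ereal (i - \<sigma> / 2 * (norm (q - c))\<^sup>2)"
    proof (cases y)
      case (real r)
      have "\<forall>\<^sub>F n in sequentially. y < f (X n)"
        using Gamma0_eventually_greater[OF f y] q unfolding filterlim_iff by blast
      then have "\<forall>\<^sub>F n in sequentially. r \<le> i + 1 / real (Suc n) - \<sigma> / 2 * (norm (X n - c))\<^sup>2"
      proof eventually_elim
        case (elim n)
        then have "r < g n" by (simp add: real g)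
        with Xr[of n] show ?case by linarith
      qed
      from tendsto_lowerbound[OF lim this] have "r \<le> i - \<sigma> / 2 * (norm (q - c))\<^sup>2" by simp
      then show ?thesis using real by simp
    qed (use y in auto)
  qed
  then have Hq: "H q \<le> ereal i" and fin: "\<bar>f q\<bar> \<noteq> \<infinity>"
    using f unfolding Gamma0_def H_def by (cases "f q"; auto)+
  show ?thesis
    by (rule that[OF fin]) (use Hq lb in \<open>unfold H_def, meson order_trans\<close>)
qed

text \<open>
  The point \<open>q\<close> minimizes \<open>f + \<sigma>/2 \<parallel>\<cdot> - v/\<sigma>\<parallel>\<^sup>2\<close>. The subgradient inequality is its
  first-order condition: compare \<open>q\<close> with \<open>q + t (x - q)\<close>, divide by \<open>t\<close>, let \<open>t\<close> tend to 0.
\<close>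
lemma Gamma0_resolvent:
  fixes f :: "'a::{real_inner,complete_space} \<Rightarrow> ereal"
  assumes f: "Gamma0 f" and s: "\<sigma> > 0"
  shows "\<exists>q. strong_subgradient 0 f q (v - \<sigma> *\<^sub>R q)"
proof -
  define c where "c = v /\<^sub>R \<sigma>"
  obtain q where fin: "\<bar>f q\<bar> \<noteq> \<infinity>"
    and q: "\<forall>x. f q + ereal (\<sigma> / 2 * (norm (q - c))\<^sup>2) \<le> f x + ereal (\<sigma> / 2 * (norm (x - c))\<^sup>2)"
    using Gamma0_quadratic_minimizer[OF f s, of c] by metis
  obtain a where a: "f q = ereal a" using fin by (metis ereal_real')
  have vc: "v - \<sigma> *\<^sub>R q = - (\<sigma> *\<^sub>R (q - c))" using s by (simp add: c_def algebra_simps)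
  have "f q + ereal ((x - q) \<bullet> (v - \<sigma> *\<^sub>R q)) \<le> f x" for x
  proof (cases "f x")
    case (real b)
    define K where "K = a - b - \<sigma> * ((x - q) \<bullet> (q - c))"
    define M where "M = \<sigma> / 2 * (norm (x - q))\<^sup>2"
    have "K \<le> t * M" if t: "t \<in> {0<..<1}" for t
    proof -
      define z where "z = (1 - t) *\<^sub>R q + t *\<^sub>R x"
      have "f z \<le> ereal (1 - t) * f q + ereal t * f x"
        unfolding z_def by (rule Gamma0_convex[OF f]) (use t in auto)
      then have "f z \<le> ereal ((1 - t) * a + t * b)" by (simp add: a real)
      moreover have "ereal (a + \<sigma> / 2 * (norm (q - c))\<^sup>2) \<le> f z + ereal (\<sigma> / 2 * (norm (z - c))\<^sup>2)"
        using q[rule_format, of z] by (simp add: a)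
      ultimately have "ereal (a + \<sigma> / 2 * (norm (q - c))\<^sup>2)
          \<le> ereal ((1 - t) * a + t * b) + ereal (\<sigma> / 2 * (norm (z - c))\<^sup>2)"
        by (meson add_right_mono order_trans)
      then have 1: "a + \<sigma> / 2 * (norm (q - c))\<^sup>2 \<le> (1 - t) * a + t * b + \<sigma> / 2 * (norm (z - c))\<^sup>2"
        by simp
      have zc: "z - c = (q - c) + t *\<^sub>R (x - q)" by (simp add: z_def algebra_simps)
      have z2: "(norm (z - c))\<^sup>2 = (norm (q - c))\<^sup>2 + 2 * t * ((x - q) \<bullet> (q - c)) + t\<^sup>2 * (norm (x - q))\<^sup>2"
        unfolding zc power2_norm_eq_inner
        by (simp only: inner_add_left inner_add_right inner_scaleR_left inner_scaleR_right)
           (simp add: inner_commute power2_eq_square algebra_simps)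
      have "\<sigma> / 2 * (norm (z - c))\<^sup>2 = \<sigma> / 2 * (norm (q - c))\<^sup>2
          + t * (\<sigma> * ((x - q) \<bullet> (q - c))) + t * (t * M)"
        unfolding z2 M_def by (simp add: algebra_simps power2_eq_square)
      then have "t * K \<le> t * (t * M)" using 1 unfolding K_def by (simp add: algebra_simps)
      then show ?thesis using t by simp
    qed
    then have ev: "\<forall>\<^sub>F t in at_right 0. K \<le> t * M" by (rule eventually_at_rightI) auto
    have "((\<lambda>t. t * M) \<longlongrightarrow> 0 * M) (at_right 0)" by (intro tendsto_intros)
    from tendsto_lowerbound[OF this ev] have "K \<le> 0" by simp
    then show ?thesis unfolding vc by (simp add: a real K_def)
  next
    case MInf
    then show ?thesis using f unfolding Gamma0_def by blast
  qed auto
  then show ?thesis using fin unfolding strong_subgradient_def by (intro exI[of _ q]) auto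
qed

text \<open>
  Holds since \<open>\<parallel>x\<parallel>\<^sup>2 = \<parallel>q\<parallel>\<^sup>2 + 2 \<langle>x - q, q\<rangle> + \<parallel>x - q\<parallel>\<^sup>2\<close>.
\<close>
lemma strong_subgradient_add_quadratic:
  assumes "strong_subgradient 0 f q (v - \<sigma> *\<^sub>R q)"
  shows "strong_subgradient \<sigma> (\<lambda>x. f x + ereal (\<sigma> / 2 * (norm x)\<^sup>2)) q v"
proof -
  obtain a where a: "f q = ereal a"
    using assms unfolding strong_subgradient_def by (metis ereal_real')
  have "f q + ereal (\<sigma> / 2 * (norm q)\<^sup>2) + ereal ((x - q) \<bullet> v + \<sigma> / 2 * (norm (x - q))\<^sup>2)
      \<le> f x + ereal (\<sigma> / 2 * (norm x)\<^sup>2)" for x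
  proof -
    have le: "f q + ereal ((x - q) \<bullet> (v - \<sigma> *\<^sub>R q)) \<le> f x"
      using assms unfolding strong_subgradient_def by simp
    have "\<sigma> / 2 * (norm x)\<^sup>2 = \<sigma> / 2 * (norm q)\<^sup>2 + \<sigma> * ((x - q) \<bullet> q) + \<sigma> / 2 * (norm (x - q))\<^sup>2"
      unfolding power2_norm_eq_inner
      by (simp add: inner_diff_left inner_diff_right inner_commute algebra_simps)
    then show ?thesis using le a
      by (cases "f x") (auto simp: inner_diff_right add_divide_distrib)
  qed
  then show ?thesis unfolding strong_subgradient_def using a by auto
qed

lemma strongly_convex_subgradient:
  fixes F :: "'a::{real_inner,complete_space} \<Rightarrow> ereal"
  assumes F: "strongly_convex \<sigma> F" and s: "\<sigma> > 0"
  shows "\<exists>q. strong_subgradient \<sigma> F q v"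
proof -
  define f where "f x = F x - ereal (\<sigma> / 2 * (norm x)\<^sup>2)" for x
  have "Gamma0 f" using F unfolding strongly_convex_def f_def by blast
  then obtain q where "strong_subgradient 0 f q (v - \<sigma> *\<^sub>R q)" using Gamma0_resolvent s by blast
  from strong_subgradient_add_quadratic[OF this]
  have "strong_subgradient \<sigma> (\<lambda>x. f x + ereal (\<sigma> / 2 * (norm x)\<^sup>2)) q v" .
  moreover have "f x + ereal (\<sigma> / 2 * (norm x)\<^sup>2) = F x" for x
    unfolding f_def by (cases "F x") auto
  ultimately show ?thesis by auto
qed

text \<open>
  A subgradient inequality for \<open>f\<close> turns into quadratic growth of the proximal objective around
  \<open>p\<close>, which gives minimality and uniqueness at once.
\<close>
lemma prox_eqI:
  assumes p: "strong_subgradient 0 f p (inverse \<alpha> *\<^sub>R (z - p))" and \<alpha>: "\<alpha> > 0"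
  shows "prox (\<lambda>v. ereal \<alpha> * f v) z = p"
proof -
  define G where "G x = ereal \<alpha> * f x + ereal (1 / 2 * (norm (x - z))\<^sup>2)" for x
  obtain a where a: "f p = ereal a"
    using p unfolding strong_subgradient_def by (metis ereal_real')
  have G: "G p + ereal (1 / 2 * (norm (x - p))\<^sup>2) \<le> G x" for x
  proof (cases "f x")
    case (real b)
    have "a + (x - p) \<bullet> (inverse \<alpha> *\<^sub>R (z - p)) \<le> b"
      using p a real unfolding strong_subgradient_def by (auto dest: spec[of _ x])
    then have "\<alpha> * (a + (x - p) \<bullet> (inverse \<alpha> *\<^sub>R (z - p))) \<le> \<alpha> * b" using \<alpha> by simp
    then have "\<alpha> * a + (x - p) \<bullet> (z - p) \<le> \<alpha> * b" using \<alpha>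
      by (simp add: distrib_left flip: mult.assoc)
    moreover have "(norm (x - z))\<^sup>2 = (norm (p - z))\<^sup>2 - 2 * ((x - p) \<bullet> (z - p)) + (norm (x - p))\<^sup>2"
      unfolding power2_norm_eq_inner
      by (simp add: inner_diff_left inner_diff_right inner_commute algebra_simps)
    ultimately show ?thesis by (simp add: G_def a real add_divide_distrib diff_divide_distrib)
  next
    case MInf
    then show ?thesis using p a unfolding strong_subgradient_def by (auto dest: spec[of _ x])
  qed (use \<alpha> in \<open>auto simp: G_def\<close>)
  have Gp: "\<bar>G p\<bar> \<noteq> \<infinity>" by (simp add: G_def a)
  have "minimizer G p"
    unfolding minimizer_def is_arg_min_def
  proof (intro conjI notI TrueI)
    assume "\<exists>y. True \<and> G y < G p"
    then obtain y where "G y < G p" by blast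
    with G[of y] have "G p + ereal (1 / 2 * (norm (y - p))\<^sup>2) < G p" by simp
    with Gp show False by (cases "G p") auto
  qed
  moreover have "x = p" if "minimizer G x" for x
  proof -
    have "G x \<le> G p" using that unfolding minimizer_def is_arg_min_def by (meson not_le)
    with G[of x] have "G p + ereal (1 / 2 * (norm (x - p))\<^sup>2) \<le> G p" by simp
    with Gp show ?thesis by (cases "G p") auto
  qed
  ultimately show ?thesis unfolding prox_def G_def[symmetric] by blast
qed

lemma prox_strong_subgradient:
  fixes f :: "'a::{real_inner,complete_space} \<Rightarrow> ereal"
  assumes f: "Gamma0 f" and \<alpha>: "\<alpha> > 0"
  shows "strong_subgradient 0 f (prox (\<lambda>v. ereal \<alpha> * f v) z)
           (inverse \<alpha> *\<^sub>R (z - prox (\<lambda>v. ereal \<alpha> * f v) z))"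
proof -
  obtain p where "strong_subgradient 0 f p (inverse \<alpha> *\<^sub>R z - inverse \<alpha> *\<^sub>R p)"
    using Gamma0_resolvent[OF f, of "inverse \<alpha>"] \<alpha> by auto
  then have p: "strong_subgradient 0 f p (inverse \<alpha> *\<^sub>R (z - p))" by (simp add: algebra_simps)
  show ?thesis using p unfolding prox_eqI[OF p \<alpha>] .
qed

text \<open>
  Monotonicity of the subdifferential, applied at the two proximal points. The inner product on the
  right is what makes the complement of the proximal map nonexpansive as well, which is how it enters
  the backward step.
\<close>
lemma prox_firmly_nonexpansive:
  fixes f :: "'a::{real_inner,complete_space} \<Rightarrow> ereal"
  assumes f: "Gamma0 f" and \<alpha>: "\<alpha> > 0"
  defines "P \<equiv> prox (\<lambda>v. ereal \<alpha> * f v)"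
  shows "(norm (P z - P z'))\<^sup>2 \<le> (P z - P z') \<bullet> (z - z')"
proof -
  have "0 \<le> (P z - P z') \<bullet> (inverse \<alpha> *\<^sub>R (z - P z) - inverse \<alpha> *\<^sub>R (z' - P z'))"
    using strong_subgradient_monotone[OF prox_strong_subgradient[OF f \<alpha>] prox_strong_subgradient[OF f \<alpha>]]
    unfolding P_def by simp
  also have "\<dots> = inverse \<alpha> * ((P z - P z') \<bullet> (z - z') - (norm (P z - P z'))\<^sup>2)"
    unfolding power2_norm_eq_inner scaleR_diff_right[symmetric] inner_scaleR_right
    by (simp add: inner_diff_right algebra_simps)
  finally show ?thesis using \<alpha> by (simp add: zero_le_mult_iff)
qed

section \<open>Conjugates and their gradients\<close>

lemma Fenchel_Young: "ereal (x \<bullet> v) - F x \<le> fenchel_conjugate F v"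
  unfolding fenchel_conjugate_def by (rule SUP_upper) simp

text \<open>
  Quadratic growth of \<open>F\<close> around \<open>q\<close> is dual to a quadratic upper bound of the conjugate around
  \<open>v\<close>. This is the descent lemma for the conjugate.
\<close>
lemma fenchel_conjugate_upper:
  assumes q: "strong_subgradient \<sigma> F q v" and s: "\<sigma> > 0" and a: "F q = ereal a"
  shows "fenchel_conjugate F v' \<le> ereal (q \<bullet> v' - a + (norm (v' - v))\<^sup>2 / (2 * \<sigma>))"
  unfolding fenchel_conjugate_def
proof (rule SUP_least)
  fix x
  have le: "ereal (a + ((x - q) \<bullet> v + \<sigma> / 2 * (norm (x - q))\<^sup>2)) \<le> F x"
    using q a unfolding strong_subgradient_def by auto
  have "0 \<le> (norm (\<sigma> *\<^sub>R (x - q) - (v' - v)))\<^sup>2 / (2 * \<sigma>)" using s by simp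
  also have "(norm (\<sigma> *\<^sub>R (x - q) - (v' - v)))\<^sup>2
      = \<sigma>\<^sup>2 * (norm (x - q))\<^sup>2 - 2 * \<sigma> * ((x - q) \<bullet> (v' - v)) + (norm (v' - v))\<^sup>2"
    unfolding power2_norm_eq_inner
    by (simp only: inner_diff_left[of "_ *\<^sub>R _"] inner_diff_right[of _ "_ *\<^sub>R _"] inner_scaleR_left inner_scaleR_right)
       (simp add: inner_commute power2_eq_square algebra_simps)
  also have "\<dots> / (2 * \<sigma>) = \<sigma> / 2 * (norm (x - q))\<^sup>2 - (x - q) \<bullet> (v' - v) + (norm (v' - v))\<^sup>2 / (2 * \<sigma>)"
    using s by (simp add: add_divide_distrib diff_divide_distrib power2_eq_square)
  finally have "(x - q) \<bullet> v' - (x - q) \<bullet> v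
      \<le> \<sigma> / 2 * (norm (x - q))\<^sup>2 + (norm (v' - v))\<^sup>2 / (2 * \<sigma>)"
    by (simp add: inner_diff_right)
  then show "ereal (x \<bullet> v') - F x \<le> ereal (q \<bullet> v' - a + (norm (v' - v))\<^sup>2 / (2 * \<sigma>))"
    using le by (cases "F x") (auto simp: inner_diff_left)
qed

lemma fenchel_conjugate_eq:
  assumes q: "strong_subgradient \<sigma> F q v" and s: "\<sigma> > 0" and a: "F q = ereal a"
  shows "fenchel_conjugate F v = ereal (q \<bullet> v - a)"
  using fenchel_conjugate_upper[OF assms, of v] Fenchel_Young[of q v F] a by simp

text \<open>
  The conjugate lies between the affine function \<open>z \<mapsto> \<langle>q, z\<rangle> - F q\<close> and the same function plus
  \<open>\<parallel>z - v\<parallel>\<^sup>2 / (2\<sigma>)\<close>, hence it is finite and differentiable at \<open>v\<close> with gradient \<open>q\<close>.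
\<close>
lemma grad_fenchel_conjugate:
  assumes q: "strong_subgradient \<sigma> F q v" and s: "\<sigma> > 0"
  shows "grad (fenchel_conjugate F) v = q"
proof -
  define C where "C = fenchel_conjugate F"
  define r where "r z = real_of_ereal (C z)" for z
  obtain a where a: "F q = ereal a"
    using q unfolding strong_subgradient_def by (metis ereal_real')
  have up: "C z \<le> ereal (q \<bullet> z - a + (norm (z - v))\<^sup>2 / (2 * \<sigma>))" for z
    unfolding C_def by (rule fenchel_conjugate_upper[OF q s a])
  have lo: "ereal (q \<bullet> z - a) \<le> C z" for z
    using Fenchel_Young[of q z F] a by (simp add: C_def)
  have C: "C z = ereal (r z)" for z
    using up[of z] lo[of z] by (cases "C z") (auto simp: r_def)
  have rv: "r v = q \<bullet> v - a" using fenchel_conjugate_eq[OF q s a] C[of v] by (simp add: C_def)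
  have rz: "\<bar>r z - r v - (z - v) \<bullet> q\<bar> \<le> (norm (z - v))\<^sup>2 / (2 * \<sigma>)" for z
    using up[of z] lo[of z] by (auto simp: C rv abs_le_iff inner_commute[of _ q] inner_diff_right)
  have G: "GDERIV r v :> q"
    unfolding gderiv_def has_derivative_iff_norm
  proof (intro conjI bounded_linear_inner_left)
    have lim: "((\<lambda>z. norm (z - v) / (2 * \<sigma>)) \<longlongrightarrow> norm (v - v) / (2 * \<sigma>)) (at v)"
      using s by (intro tendsto_intros) auto
    have le: "norm (norm (r z - r v - (z - v) \<bullet> q) / norm (z - v)) \<le> norm (z - v) / (2 * \<sigma>)" for z
    proof (cases "z = v")
      case False
      then show ?thesis using rz[of z] by (simp add: divide_le_eq power2_eq_square)
    qed simp
    show "((\<lambda>z. norm (r z - r v - (z - v) \<bullet> q) / norm (z - v)) \<longlongrightarrow> 0) (at v)"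
    proof (rule Lim_null_comparison)
      show "\<forall>\<^sub>F z in at v. norm (norm (r z - r v - (z - v) \<bullet> q) / norm (z - v)) \<le> norm (z - v) / (2 * \<sigma>)"
        by (rule always_eventually) (rule allI, rule le)
      show "((\<lambda>z. norm (z - v) / (2 * \<sigma>)) \<longlongrightarrow> 0) (at v)" using lim by simp
    qed
  qed
  have uniq: "g = q" if "GDERIV r v :> g" for g
  proof -
    have "(\<lambda>h. h \<bullet> g) = (\<lambda>h. h \<bullet> q)"
      using has_derivative_unique that G unfolding gderiv_def by blast
    from fun_cong[OF this, of "g - q"] have "(g - q) \<bullet> g = (g - q) \<bullet> q" .
    then have "(g - q) \<bullet> (g - q) = 0" by (simp add: inner_diff_right)
    then show ?thesis by simp
  qed
  show ?thesis
    unfolding grad_def C_def[symmetric] r_def[symmetric]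
  proof (rule the_equality)
    show "(\<forall>\<^sub>F z in nhds v. \<bar>C z\<bar> \<noteq> \<infinity>) \<and> GDERIV r v :> q" using G by (simp add: C)
  qed (blast intro: uniq)
qed

text \<open>
  A perturbation is measured on the proximal maps of \<open>J\<close>, while the method uses gradients of
  \<open>\<psi>*\<close>; both solve the same resolvent inclusion.
\<close>
lemma grad_fenchel_conjugate_prox:
  fixes J :: "'a::{real_inner,complete_space} \<Rightarrow> ereal"
  assumes J: "Gamma0 J" and s: "\<sigma> > 0"
  defines "\<psi> \<equiv> \<lambda>x. J x + ereal (\<sigma> / 2 * (norm x)\<^sup>2)"
  shows "strong_subgradient \<sigma> \<psi> (grad (fenchel_conjugate \<psi>) v) v"
    and "grad (fenchel_conjugate \<psi>) v = prox (\<lambda>v. J v / ereal \<sigma>) (inverse \<sigma> *\<^sub>R v)"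
proof -
  obtain q where q: "strong_subgradient 0 J q (v - \<sigma> *\<^sub>R q)" using Gamma0_resolvent[OF J s] by blast
  have sub: "strong_subgradient \<sigma> \<psi> q v" unfolding \<psi>_def by (rule strong_subgradient_add_quadratic[OF q])
  have gr: "grad (fenchel_conjugate \<psi>) v = q" by (rule grad_fenchel_conjugate[OF sub s])
  show "strong_subgradient \<sigma> \<psi> (grad (fenchel_conjugate \<psi>) v) v" unfolding gr by (rule sub)
  have "prox (\<lambda>v. ereal (inverse \<sigma>) * J v) (inverse \<sigma> *\<^sub>R v) = q"
    using q s by (intro prox_eqI) (auto simp: scaleR_diff_right)
  moreover have "(\<lambda>v. J v / ereal \<sigma>) = (\<lambda>v. ereal (inverse \<sigma>) * J v)"
    using s by (simp add: divide_ereal_def mult.commute)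
  ultimately show "grad (fenchel_conjugate \<psi>) v = prox (\<lambda>v. J v / ereal \<sigma>) (inverse \<sigma> *\<^sub>R v)"
    using gr by simp
qed

text \<open>
  This is convexity of \<open>F*\<close> on the segment from 0 to \<open>\<mu> u\<close>, because \<open>F* 0 \<le> 0\<close> for nonnegative
  \<open>F\<close>. It makes \<open>F*(\<mu> u) / \<mu>\<close> nondecreasing in \<open>\<mu>\<close>.
\<close>
lemma fenchel_conjugate_scale:
  assumes F: "\<And>x. 0 \<le> F x" and \<mu>: "0 < \<mu>'" "\<mu>' \<le> \<mu>"
    and c: "fenchel_conjugate F (\<mu> *\<^sub>R u) = ereal c"
  shows "fenchel_conjugate F (\<mu>' *\<^sub>R u) \<le> ereal (\<mu>' * (c / \<mu>))"
  unfolding fenchel_conjugate_def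
proof (rule SUP_least)
  fix x
  show "ereal (x \<bullet> (\<mu>' *\<^sub>R u)) - F x \<le> ereal (\<mu>' * (c / \<mu>))"
  proof (cases "F x")
    case (real r)
    have r: "0 \<le> r" using F[of x] real by simp
    have "\<mu> * (x \<bullet> u) - r \<le> c"
      using Fenchel_Young[of x "\<mu> *\<^sub>R u" F] by (simp add: c real)
    then have "\<mu>' / \<mu> * (\<mu> * (x \<bullet> u) - r) \<le> \<mu>' / \<mu> * c" using \<mu> by (intro mult_left_mono) auto
    moreover have "\<mu>' / \<mu> * r \<le> 1 * r" using \<mu> r by (intro mult_right_mono) auto
    ultimately have "\<mu>' * (x \<bullet> u) - r \<le> \<mu>' / \<mu> * c" using \<mu> by (simp add: right_diff_distrib)
    then show ?thesis by (simp add: real)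
  next
    case MInf
    then show ?thesis using F[of x] by simp
  qed simp
qed

section \<open>Adjoints on Hilbert spaces\<close>

text \<open>
  A resolvent point \<open>q\<close> of the linear functional satisfies \<open>l h \<ge> - \<langle>h, q\<rangle>\<close> for all \<open>h\<close>; replacing
  \<open>h\<close> by \<open>- h\<close> gives equality.
\<close>
lemma Riesz_representation:
  fixes l :: "'a::{real_inner,complete_space} \<Rightarrow> real"
  assumes l: "bounded_linear l"
  shows "\<exists>r. \<forall>x. l x = x \<bullet> r"
proof -
  interpret l: bounded_linear l by (rule l)
  have "Gamma0 (\<lambda>x. ereal (l x))"
    unfolding Gamma0_def
  proof (intro conjI allI impI)
    fix x
    have "isCont l x" by (intro l.isCont continuous_ident)
    then have "((\<lambda>x. ereal (l x)) \<longlongrightarrow> ereal (l x)) (at x)"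
      unfolding isCont_def by (rule tendsto_ereal)
    then show "ereal (l x) \<le> Liminf (at x) (\<lambda>x. ereal (l x))"
      unfolding le_Liminf_iff by (metis order_tendstoD(1))
  qed (auto simp: l.add l.scaleR)
  then obtain q where q: "strong_subgradient 0 (\<lambda>x. ereal (l x)) q (0 - 1 *\<^sub>R q)"
    using Gamma0_resolvent zero_less_one by blast
  have ge: "- (h \<bullet> q) \<le> l h" for h
    using q unfolding strong_subgradient_def by (auto dest: spec[of _ "q + h"] simp: l.add)
  have "l h = h \<bullet> (- q)" for h
    using ge[of h] ge[of "- h"] l.scaleR[of "- 1" h] by simp
  then show ?thesis by blast
qed

text \<open>
  The constant \<open>adjoint\<close> is defined by a choice operator and so is only meaningful once an adjoint exists;
  existence is where completeness of the domain enters.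
\<close>
lemma inner_adjoint:
  fixes A :: "'a::{real_inner,complete_space} \<Rightarrow> 'b::real_inner"
  assumes A: "bounded_linear A"
  shows "A x \<bullet> y = x \<bullet> adjoint A y"
proof -
  have "\<forall>y. \<exists>r. \<forall>x. A x \<bullet> y = x \<bullet> r"
  proof
    fix y
    show "\<exists>r. \<forall>x. A x \<bullet> y = x \<bullet> r"
      by (rule Riesz_representation) (rule bounded_linear_compose[OF bounded_linear_inner_left A])
  qed
  from choice[OF this] have "\<exists>A'. \<forall>x y. A x \<bullet> y = x \<bullet> A' y" by blast
  from someI_ex[OF this] show ?thesis unfolding adjoint_def by blast
qed

lemma adjoint_minus:
  fixes A :: "'a::{real_inner,complete_space} \<Rightarrow> 'b::real_inner"
  assumes A: "bounded_linear A"
  shows "adjoint A (- y) = - adjoint A y"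
proof -
  have "x \<bullet> adjoint A (- y) = x \<bullet> (- adjoint A y)" for x
    using inner_adjoint[OF A, of x "- y"] inner_adjoint[OF A, of x y] by simp
  then show ?thesis using vector_eq_ldot by blast
qed

lemma norm_adjoint_diff_le:
  fixes A :: "'a::{real_inner,complete_space} \<Rightarrow> 'b::real_inner"
  assumes A: "bounded_linear A"
  shows "norm (adjoint A y - adjoint A y') \<le> onorm A * norm (y - y')"
proof -
  define z where "z = adjoint A y - adjoint A y'"
  have "norm z * norm z = A z \<bullet> (y - y')"
    unfolding inner_diff_right inner_adjoint[OF A] inner_diff_right[symmetric] z_def[symmetric]
    by (simp add: power2_norm_eq_inner flip: power2_eq_square)
  also have "\<dots> \<le> norm (A z) * norm (y - y')" by (rule norm_cauchy_schwarz)
  also have "\<dots> \<le> onorm A * norm z * norm (y - y')"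
    by (intro mult_right_mono onorm[OF A]) auto
  finally have "norm z * norm z \<le> norm z * (onorm A * norm (y - y'))" by (simp add: mult_ac)
  then show ?thesis
    using onorm_pos_le[OF A] unfolding z_def[symmetric] by (cases "z = 0") auto
qed

section \<open>Conditioning and the size of the conjugate near the origin\<close>

text \<open>
  The power lower bound of the modulus is only local. Beyond a radius \<open>\<rho>\<close> inside its range, convexity
  of the modulus and its vanishing at 0 give linear growth with the slope reached at \<open>\<rho>\<close>.
\<close>
lemma well_conditioned_growth:
  assumes wc: "well_conditioned p F m" and F: "minimizer F x0" "F x0 = 0" and p: "p \<ge> 1"
  obtains \<rho> g where "\<rho> > 0" "g > 0"
    "\<forall>z. norm (z - x0) \<le> \<rho> \<longrightarrow> ereal (g * norm (z - x0) powr p) \<le> F z"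
    "\<forall>z. norm (z - x0) > \<rho> \<longrightarrow> ereal (g * \<rho> powr p / \<rho> * norm (z - x0)) \<le> F z"
proof -
  have m: "Gamma0 m" "\<And>t. 0 \<le> m t" and mF: "\<And>z. m (norm (z - x0)) \<le> F z"
    using wc F unfolding well_conditioned_def conditioning_modulus_def by auto
  obtain \<epsilon> \<gamma> where eg: "\<epsilon> > 0" "\<gamma> > 0"
    and low: "\<forall>t\<in>{-\<epsilon><..<\<epsilon>}. ereal (\<gamma> / p * \<bar>t\<bar> powr p) \<le> m t"
    using wc unfolding well_conditioned_def by blast
  define \<rho> g where "\<rho> = \<epsilon> / 2" and "g = \<gamma> / p"
  have pos: "\<rho> > 0" "g > 0" using eg p by (auto simp: \<rho>_def g_def)
  have m0: "m 0 = 0" using mF[of x0] m(2)[of 0] F(2) by (simp add: antisym)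
  have near: "ereal (g * s powr p) \<le> m s" if "0 \<le> s" "s \<le> \<rho>" for s
    using low[rule_format, of s] that eg by (simp add: g_def \<rho>_def)
  have far: "ereal (g * \<rho> powr p / \<rho> * s) \<le> m s" if s: "s > \<rho>" for s
  proof (cases "m s")
    case (real b)
    define t where "t = \<rho> / s"
    have t: "0 < t" "t < 1" using s pos by (auto simp: t_def)
    have "m ((1 - t) *\<^sub>R 0 + t *\<^sub>R s) \<le> ereal (1 - t) * m 0 + ereal t * m s"
      by (rule Gamma0_convex[OF m(1) t])
    moreover have "(1 - t) *\<^sub>R 0 + t *\<^sub>R s = \<rho>" using s pos by (simp add: t_def)
    ultimately have "m \<rho> \<le> ereal (t * b)" by (simp add: m0 real)
    with near[of \<rho>] pos have "ereal (g * \<rho> powr p) \<le> ereal (t * b)" by (meson order_trans less_imp_le order_refl)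
    then have "g * \<rho> powr p \<le> \<rho> / s * b" by (simp add: t_def)
    then have "g * \<rho> powr p / \<rho> * s \<le> b" using pos s by (simp add: field_simps)
    then show ?thesis by (simp add: real)
  next
    case MInf
    then show ?thesis using m(2)[of s] by simp
  qed simp
  show ?thesis
    by (rule that[OF pos]) (use near far mF norm_ge_zero order_trans in blast)+
qed

text \<open>
  Growth of order \<open>p\<close> of \<open>F\<close> is dual to smallness of order \<open>p / (p - 1)\<close> of
  \<open>F* - \<langle>x0, \<cdot>\<rangle>\<close> near 0. The restriction \<open>norm v \<le> G\<close> makes the linear growth at large distance
  dominate. In the sharp case \<open>p = 1\<close> the excess vanishes; that case is separated because the exponent
  \<open>1 / (p - 1)\<close> would be \<open>1 / 0 = 0\<close> and the formula would lose all decay.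
\<close>
lemma well_conditioned_conjugate:
  fixes F :: "'a::real_inner \<Rightarrow> ereal"
  assumes wc: "well_conditioned p F m" and F: "minimizer F x0" "F x0 = 0" and p: "p \<ge> 1"
  obtains G g where "G > 0" "g > 0"
    "\<forall>v. norm v \<le> G \<longrightarrow> fenchel_conjugate F v
       \<le> ereal (x0 \<bullet> v + (if p = 1 then 0 else norm v * (norm v / g) powr (1 / (p - 1))))"
proof -
  obtain \<rho> g where pos: "\<rho> > 0" "g > 0"
    and near: "\<forall>z. norm (z - x0) \<le> \<rho> \<longrightarrow> ereal (g * norm (z - x0) powr p) \<le> F z"
    and far: "\<forall>z. norm (z - x0) > \<rho> \<longrightarrow> ereal (g * \<rho> powr p / \<rho> * norm (z - x0)) \<le> F z"
    by (rule well_conditioned_growth[OF wc F p])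
  define G where "G = g * \<rho> powr p / \<rho>"
  have G: "G > 0" using pos by (simp add: G_def)
  define E where "E v = (if p = 1 then 0 else norm v * (norm v / g) powr (1 / (p - 1)))" for v :: 'a
  have E: "0 \<le> E v" for v by (simp add: E_def)
  have bound: "fenchel_conjugate F v \<le> ereal (x0 \<bullet> v + E v)" if v: "norm v \<le> G" for v
    unfolding fenchel_conjugate_def
  proof (rule SUP_least)
    fix z
    define s where "s = norm (z - x0)"
    have s0: "s \<ge> 0" by (simp add: s_def)
    have "ereal (norm v * s - E v) \<le> F z"
    proof (cases "s \<le> \<rho>")
      case True
      have "norm v * s - E v \<le> g * s powr p"
      proof (cases "p = 1 \<or> s = 0")
        case True
        then show ?thesis
        proof
          assume p1: "p = 1"
          then have "norm v \<le> g" using v pos by (simp add: G_def)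
          then show ?thesis using p1 s0 by (simp add: E_def mult_right_mono)
        qed (use p E in simp)
      next
        case False
        then have s: "s > 0" and p1: "p > 1" using s0 p by auto
        \<comment> \<open>Either the power already dominates, or \<open>s\<close> is below the point
          \<open>(norm v / g) powr (1 / (p - 1))\<close> where \<open>g s\<^sup>p\<close> overtakes \<open>norm v * s\<close>.\<close>
        show ?thesis
        proof (cases "norm v * s \<le> g * s powr p")
          case True
          then show ?thesis using E[of v] by simp
        next
          case False
          have "s powr p = s * s powr (p - 1)" using s by (simp add: powr_mult_base)
          then have "s * (g * s powr (p - 1)) < s * norm v" using False by (simp add: mult_ac)
          then have "s powr (p - 1) \<le> norm v / g" using s pos by (simp add: field_simps)
          then have "(s powr (p - 1)) powr (1 / (p - 1)) \<le> (norm v / g) powr (1 / (p - 1))"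
            using p1 by (intro powr_mono2) auto
          then have "s \<le> (norm v / g) powr (1 / (p - 1))" using p1 s by (simp add: powr_powr)
          then have "norm v * s \<le> E v" using p1 by (simp add: E_def mult_left_mono)
          then show ?thesis using pos by (smt (verit) mult_nonneg_nonneg powr_ge_zero)
        qed
      qed
      then have "ereal (norm v * s - E v) \<le> ereal (g * s powr p)" by simp
      also have "\<dots> \<le> F z" using near True by (simp add: s_def)
      finally show ?thesis .
    next
      case False
      have "norm v * s - E v \<le> G * s" using mult_right_mono[OF v s0] E[of v] by simp
      then have "ereal (norm v * s - E v) \<le> ereal (G * s)" by simp
      also have "\<dots> \<le> F z" using far False by (simp add: s_def G_def)
      finally show ?thesis .
    qed
    moreover have "z \<bullet> v \<le> x0 \<bullet> v + norm v * s"
      using norm_cauchy_schwarz[of "z - x0" v] by (simp add: s_def inner_diff_left mult.commute)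
    ultimately show "ereal (z \<bullet> v) - F z \<le> ereal (x0 \<bullet> v + E v)"
      by (cases "F z") auto
  qed
  show ?thesis
    by (rule that[OF G pos(2)]) (use bound in \<open>simp add: E_def\<close>)
qed

text \<open>
  The terms are a constant times \<open>(n + 1) powr (- \<beta> / (p - 1))\<close>. This is where the lower bound on
  the decay exponent \<open>\<beta>\<close> is used.
\<close>
lemma summable_conditioning_error:
  fixes lam :: "nat \<Rightarrow> real"
  assumes lam: "\<And>n. lam n = l / (real n + 1) powr \<beta>" and l: "l > 0"
    and p: "p > 1" "\<beta> > p - 1" and a: "a \<ge> 0" and g: "g > 0"
  shows "summable (\<lambda>n. a * (lam n * a / g) powr (1 / (p - 1)))"
proof -
  have eq: "a * (lam n * a / g) powr (1 / (p - 1))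
      = a * (l * a / g) powr (1 / (p - 1)) * real (Suc n) powr (- \<beta> / (p - 1))" for n
  proof -
    have split: "lam n * a / g = l * a / g * real (Suc n) powr (- \<beta>)"
      by (simp add: lam powr_minus divide_inverse add.commute)
    have "(lam n * a / g) powr (1 / (p - 1))
        = (l * a / g) powr (1 / (p - 1)) * (real (Suc n) powr (- \<beta>)) powr (1 / (p - 1))"
      unfolding split using l a g by (intro powr_mult)
    then show ?thesis by (simp add: powr_powr)
  qed
  have "- \<beta> / (p - 1) < - 1" using p by (simp add: field_simps)
  then have "summable (\<lambda>n. real n powr (- \<beta> / (p - 1)))" by (simp add: summable_real_powr_iff)
  then have "summable (\<lambda>n. real (Suc n) powr (- \<beta> / (p - 1)))"
    by (subst summable_Suc_iff)
  then show ?thesis unfolding eq by (rule summable_mult)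
qed

section \<open>Nonexpansiveness of the dual forward-backward step\<close>

text \<open>
  The assumptions on \<open>R\<close> and \<open>\<psi>\<close> express their strong convexity in the only form in which it is
  used. \<open>\<Lambda>\<close> is an upper bound for the regularisation parameters, so that one step size serves all of
  them.
\<close>
locale dual_forward_backward =
  fixes A :: "'x::{real_inner,complete_space} \<Rightarrow> 'y::{real_inner,complete_space}"
    and R :: "'x \<Rightarrow> ereal" and \<psi> \<phi> :: "'y \<Rightarrow> ereal"
    and \<sigma>R \<sigma>\<psi> \<tau> \<Lambda> :: real
  assumes A: "bounded_linear A"
    and \<sigma>: "\<sigma>R > 0" "\<sigma>\<psi> > 0"
    and R: "\<And>v. strong_subgradient \<sigma>R R (grad (fenchel_conjugate R) v) v"
    and \<psi>: "\<And>v. strong_subgradient \<sigma>\<psi> \<psi> (grad (fenchel_conjugate \<psi>) v) v"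
    and \<phi>: "Gamma0 \<phi>"
    and \<tau>: "0 < \<tau>" "\<tau> \<le> 1 / ((onorm A)\<^sup>2 / \<sigma>R + \<Lambda> / \<sigma>\<psi>)"
    and \<Lambda>: "\<Lambda> > 0"
begin

definition primal :: "'y \<Rightarrow> 'x" where
  "primal u = grad (fenchel_conjugate R) (- adjoint A u)"

definition forward :: "real \<Rightarrow> 'y \<Rightarrow> 'y" where
  "forward \<mu> u = u + \<tau> *\<^sub>R A (primal u) - \<tau> *\<^sub>R grad (fenchel_conjugate \<psi>) (\<mu> *\<^sub>R u)"

text \<open>
  By Moreau's decomposition this is the proximal map of \<open>\<tau>\<close> times \<open>v \<mapsto> \<phi>*(\<mu> v) / \<mu>\<close>.
\<close>
definition backward :: "real \<Rightarrow> 'y \<Rightarrow> 'y" where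
  "backward \<mu> w = w - \<tau> *\<^sub>R prox (\<lambda>v. ereal (inverse (\<tau> * \<mu>)) * \<phi> v) (inverse \<tau> *\<^sub>R w)"

definition step :: "real \<Rightarrow> 'y \<Rightarrow> 'y" where
  "step \<mu> u = backward \<mu> (forward \<mu> u)"

lemma stepsize:
  assumes "0 < \<mu>" "\<mu> \<le> \<Lambda>"
  shows "\<tau> * ((onorm A)\<^sup>2 / \<sigma>R + \<mu> / \<sigma>\<psi>) \<le> 1"
    and "\<tau> * ((onorm A)\<^sup>2 / \<sigma>R) \<le> 1" and "\<tau> * (\<mu> / \<sigma>\<psi>) \<le> 1"
proof -
  have K: "0 \<le> \<tau> * ((onorm A)\<^sup>2 / \<sigma>R)" "0 \<le> \<tau> * (\<mu> / \<sigma>\<psi>)" using \<sigma> \<tau> assms by auto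
  have "0 \<le> (onorm A)\<^sup>2 / \<sigma>R" "0 < \<Lambda> / \<sigma>\<psi>" using \<sigma> \<Lambda> by auto
  then have "\<tau> * ((onorm A)\<^sup>2 / \<sigma>R + \<Lambda> / \<sigma>\<psi>) \<le> 1" using \<tau>(2) by (simp add: pos_le_divide_eq)
  moreover have "\<tau> * (\<mu> / \<sigma>\<psi>) \<le> \<tau> * (\<Lambda> / \<sigma>\<psi>)"
    using \<sigma> \<tau> assms by (intro mult_left_mono divide_right_mono) auto
  ultimately show "\<tau> * ((onorm A)\<^sup>2 / \<sigma>R + \<mu> / \<sigma>\<psi>) \<le> 1"
    and "\<tau> * ((onorm A)\<^sup>2 / \<sigma>R) \<le> 1" and "\<tau> * (\<mu> / \<sigma>\<psi>) \<le> 1"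
    using K unfolding distrib_left by linarith+
qed

text \<open>
  Cocoercivity of the gradient \<open>u \<mapsto> - A (primal u)\<close> of \<open>u \<mapsto> R*(- A* u)\<close>.
\<close>
lemma primal_monotone: "\<sigma>R * (norm (primal u - primal u'))\<^sup>2 \<le> - (A (primal u - primal u') \<bullet> (u - u'))"
  using strong_subgradient_monotone[OF R R, of "- adjoint A u" "- adjoint A u'"]
  unfolding primal_def[symmetric]
  by (simp add: inner_diff_right inner_adjoint[OF A])

lemma primal_Lipschitz: "norm (primal u - primal u') \<le> onorm A / \<sigma>R * norm (u - u')"
proof -
  define X where "X = primal u - primal u'"
  have "\<sigma>R * (norm X)\<^sup>2 \<le> - (A X \<bullet> (u - u'))" unfolding X_def by (rule primal_monotone)
  also have "\<dots> \<le> norm (A X) * norm (u - u')" using Cauchy_Schwarz_ineq2[of "A X" "u - u'"] by simp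
  also have "\<dots> \<le> onorm A * norm X * norm (u - u')" by (intro mult_right_mono onorm[OF A]) auto
  finally have "norm X * (\<sigma>R * norm X) \<le> norm X * (onorm A * norm (u - u'))"
    by (simp add: mult_ac power2_eq_square)
  then have "\<sigma>R * norm X \<le> onorm A * norm (u - u')"
    using onorm_pos_le[OF A] by (cases "X = 0") auto
  then show ?thesis unfolding X_def using \<sigma> by (simp add: field_simps)
qed

text \<open>
  Each of the two gradients is cocoercive, so the cross term of the squared distance is at most
  \<open>- 2\<tau> (s + r)\<close> with \<open>s\<close>, \<open>r\<close> the two cocoercivity gains. The step-size restriction makes the
  quadratic term at most that large, even after the crude bound
  \<open>\<parallel>a - b\<parallel>\<^sup>2 \<le> 2\<parallel>a\<parallel>\<^sup>2 + 2\<parallel>b\<parallel>\<^sup>2\<close>.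
\<close>
lemma forward_nonexpansive:
  assumes \<mu>: "0 < \<mu>" "\<mu> \<le> \<Lambda>"
  shows "norm (forward \<mu> u - forward \<mu> u') \<le> norm (u - u')"
proof -
  define U X Q where "U = u - u'" and "X = primal u - primal u'"
    and "Q = grad (fenchel_conjugate \<psi>) (\<mu> *\<^sub>R u) - grad (fenchel_conjugate \<psi>) (\<mu> *\<^sub>R u')"
  interpret A: bounded_linear A by (rule A)
  define s r where "s = \<sigma>R * (norm X)\<^sup>2" and "r = \<sigma>\<psi> / \<mu> * (norm Q)\<^sup>2"
  have sr: "0 \<le> s" "0 \<le> r" using \<sigma> \<mu> by (auto simp: s_def r_def)
  have s: "s \<le> - (A X \<bullet> U)" unfolding s_def X_def U_def by (rule primal_monotone)
  have "\<sigma>\<psi> * (norm Q)\<^sup>2 \<le> Q \<bullet> (\<mu> *\<^sub>R u - \<mu> *\<^sub>R u')"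
    unfolding Q_def by (rule strong_subgradient_monotone[OF \<psi> \<psi>])
  also have "\<dots> = \<mu> * (Q \<bullet> U)" by (simp add: U_def algebra_simps)
  finally have r: "r \<le> Q \<bullet> U" using \<mu> by (simp add: r_def field_simps)
  have "(norm (A X))\<^sup>2 \<le> (onorm A * norm X)\<^sup>2"
    by (intro power_mono onorm[OF A]) auto
  also have "\<dots> = (onorm A)\<^sup>2 / \<sigma>R * s" using \<sigma> by (simp add: s_def power_mult_distrib)
  finally have AX: "(norm (A X))\<^sup>2 \<le> (onorm A)\<^sup>2 / \<sigma>R * s" .
  have Q: "(norm Q)\<^sup>2 = \<mu> / \<sigma>\<psi> * r" using \<sigma> \<mu> by (simp add: r_def)
  have "norm (A X - Q) \<le> norm (A X) + norm Q" by (rule norm_triangle_ineq4)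
  then have "(norm (A X - Q))\<^sup>2 \<le> (norm (A X) + norm Q)\<^sup>2" by (intro power_mono) auto
  also have "\<dots> \<le> 2 * (norm (A X))\<^sup>2 + 2 * (norm Q)\<^sup>2"
    using sum_squares_bound[of "norm (A X)" "norm Q"] by (simp add: power2_sum)
  finally have "\<tau> * (norm (A X - Q))\<^sup>2 \<le> \<tau> * (2 * ((onorm A)\<^sup>2 / \<sigma>R * s) + 2 * (\<mu> / \<sigma>\<psi> * r))"
    using AX Q \<tau>(1) by (intro mult_left_mono) auto
  also have "\<dots> = 2 * (\<tau> * ((onorm A)\<^sup>2 / \<sigma>R) * s) + 2 * (\<tau> * (\<mu> / \<sigma>\<psi>) * r)"
    by (simp add: distrib_left mult_ac)
  also have "\<dots> \<le> 2 * (1 * s) + 2 * (1 * r)"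
    using stepsize[OF \<mu>] sr by (intro add_mono mult_left_mono mult_right_mono) auto
  also have "\<dots> \<le> - 2 * (A X \<bullet> U) + 2 * (Q \<bullet> U)" using s r by simp
  finally have main: "\<tau> * (norm (A X - Q))\<^sup>2 \<le> - 2 * ((A X - Q) \<bullet> U)" by (simp add: inner_diff_left)
  have eq: "forward \<mu> u - forward \<mu> u' = U + \<tau> *\<^sub>R (A X - Q)"
    by (simp add: forward_def U_def X_def Q_def A.diff algebra_simps)
  have "(norm (U + \<tau> *\<^sub>R (A X - Q)))\<^sup>2
      = (norm U)\<^sup>2 + \<tau> * (2 * ((A X - Q) \<bullet> U) + \<tau> * (norm (A X - Q))\<^sup>2)"
    unfolding power2_norm_eq_inner
    by (simp only: inner_add_left inner_add_right inner_scaleR_left inner_scaleR_right)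
       (simp add: inner_commute algebra_simps)
  also have "\<dots> \<le> (norm U)\<^sup>2 + \<tau> * 0"
    using main \<tau> by (intro add_left_mono mult_left_mono) auto
  finally have "(norm (U + \<tau> *\<^sub>R (A X - Q)))\<^sup>2 \<le> (norm U)\<^sup>2" by simp
  then show ?thesis unfolding eq U_def[symmetric] by (rule power2_le_imp_le) simp
qed

text \<open>
  The optimality condition of the proximal point says that the new dual iterate, scaled by \<open>\<mu>\<close>, is a
  subgradient of \<open>\<phi>\<close> there.
\<close>
lemma backward_subgradient:
  assumes \<mu>: "0 < \<mu>"
  shows "strong_subgradient 0 \<phi> (prox (\<lambda>v. ereal (inverse (\<tau> * \<mu>)) * \<phi> v) (inverse \<tau> *\<^sub>R w))
           (\<mu> *\<^sub>R backward \<mu> w)"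
proof -
  have "inverse (\<tau> * \<mu>) > 0" using \<mu> \<tau> by simp
  from prox_strong_subgradient[OF \<phi> this, of "inverse \<tau> *\<^sub>R w"]
  show ?thesis using \<tau> by (simp add: backward_def algebra_simps)
qed

lemma backward_nonexpansive:
  assumes \<mu>: "0 < \<mu>"
  shows "norm (backward \<mu> w - backward \<mu> w') \<le> norm (w - w')"
proof -
  define p where "p w = prox (\<lambda>v. ereal (inverse (\<tau> * \<mu>)) * \<phi> v) (inverse \<tau> *\<^sub>R w)" for w
  define P where "P = p w - p w'"
  have "inverse (\<tau> * \<mu>) > 0" using \<mu> \<tau> by simp
  from prox_firmly_nonexpansive[OF \<phi> this, of "inverse \<tau> *\<^sub>R w" "inverse \<tau> *\<^sub>R w'"]
  have "(norm P)\<^sup>2 \<le> P \<bullet> (inverse \<tau> *\<^sub>R (w - w'))"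
    by (simp add: P_def p_def scaleR_diff_right)
  then have "\<tau> * (norm P)\<^sup>2 \<le> P \<bullet> (w - w')"
    unfolding inner_scaleR_right using \<tau>(1) by (simp add: field_simps)
  moreover have "0 \<le> \<tau> * (norm P)\<^sup>2" using \<tau> by simp
  ultimately have le: "\<tau> * (norm P)\<^sup>2 \<le> 2 * (P \<bullet> (w - w'))" by linarith
  have eq: "backward \<mu> w - backward \<mu> w' = (w - w') - \<tau> *\<^sub>R P"
    by (simp add: backward_def P_def p_def algebra_simps)
  have "(norm ((w - w') - \<tau> *\<^sub>R P))\<^sup>2
      = (norm (w - w'))\<^sup>2 - \<tau> * (2 * (P \<bullet> (w - w')) - \<tau> * (norm P)\<^sup>2)"
    unfolding power2_norm_eq_inner
    by (simp only: inner_diff_left[of "_ - _"] inner_diff_right[of _ "_ - _"] inner_scaleR_left inner_scaleR_right)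
       (simp add: inner_commute algebra_simps)
  also have "\<dots> \<le> (norm (w - w'))\<^sup>2" using le \<tau> by simp
  finally show ?thesis unfolding eq by (rule power2_le_imp_le) simp
qed

lemma step_nonexpansive:
  assumes "0 < \<mu>" "\<mu> \<le> \<Lambda>"
  shows "norm (step \<mu> u - step \<mu> u') \<le> norm (u - u')"
  unfolding step_def
  using backward_nonexpansive[OF assms(1)] forward_nonexpansive[OF assms] order_trans by blast

section \<open>Descent of the dual objective\<close>

definition smooth_dual :: "'y \<Rightarrow> real" where
  "smooth_dual u = real_of_ereal (fenchel_conjugate R (- adjoint A u))"

lemma R_conjugate_finite: "fenchel_conjugate R (- adjoint A u) = ereal (smooth_dual u)"
proof -
  obtain a where "R (grad (fenchel_conjugate R) (- adjoint A u)) = ereal a"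
    using R[of "- adjoint A u"] unfolding strong_subgradient_def by (metis ereal_real')
  from fenchel_conjugate_eq[OF R \<sigma>(1) this] show ?thesis unfolding smooth_dual_def by simp
qed

text \<open>
  The descent lemma from \<open>u\<close> to \<open>u'\<close> combined with the gradient inequality from \<open>u\<close> to \<open>v\<close>,
  both for \<open>u \<mapsto> R*(- A* u)\<close>.
\<close>
lemma smooth_dual_step:
  "smooth_dual u' \<le> smooth_dual v - A (primal u) \<bullet> (u' - v) + (onorm A)\<^sup>2 / \<sigma>R / 2 * (norm (u' - u))\<^sup>2"
proof -
  obtain a where a: "R (primal u) = ereal a"
    using R[of "- adjoint A u"] unfolding strong_subgradient_def primal_def by (metis ereal_real')
  have "smooth_dual u' \<le> primal u \<bullet> (- adjoint A u') - a + (norm (- adjoint A u' - - adjoint A u))\<^sup>2 / (2 * \<sigma>R)"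
    using fenchel_conjugate_upper[OF R \<sigma>(1), of "- adjoint A u" a "- adjoint A u'"] a
    by (simp add: R_conjugate_finite primal_def)
  moreover have "(norm (- adjoint A u' - - adjoint A u))\<^sup>2 \<le> (onorm A * norm (u' - u))\<^sup>2"
    using norm_adjoint_diff_le[OF A, of u u'] by (intro power_mono) (auto simp: norm_minus_commute)
  then have "(norm (- adjoint A u' - - adjoint A u))\<^sup>2 / (2 * \<sigma>R) \<le> (onorm A)\<^sup>2 / \<sigma>R / 2 * (norm (u' - u))\<^sup>2"
    using \<sigma> by (simp add: power_mult_distrib field_simps)
  moreover have "primal u \<bullet> (- adjoint A v) - a \<le> smooth_dual v"
    using Fenchel_Young[of "primal u" "- adjoint A v" R] a by (simp add: R_conjugate_finite)
  ultimately show ?thesis by (simp add: inner_diff_right inner_adjoint[OF A])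
qed

text \<open>
  The counterpart of \<open>smooth_dual_step\<close> for the term \<open>D*(\<mu> u)\<close>. With \<open>q\<close> the gradient of
  \<open>\<psi>*\<close> at \<open>\<mu> u\<close> and \<open>p\<close> the proximal point, the upper bound at the new iterate uses that
  \<open>q\<close> is a strong subgradient point of \<open>\<psi>\<close> and \<open>p\<close> a subgradient point of \<open>\<phi>\<close> for the new
  iterate. The lower bound at \<open>v\<close> tests the conjugate of \<open>D\<close> at the single point \<open>q + p\<close>. The
  vector paired with \<open>step \<mu> u - v\<close> is \<open>q + p\<close> rewritten through the definition of the step.
\<close>
lemma conjugate_step:
  assumes \<mu>: "0 < \<mu>"
  defines "D \<equiv> inf_convolution \<psi> \<phi>"
  shows "fenchel_conjugate D (\<mu> *\<^sub>R step \<mu> u) < \<infinity>"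
    and "fenchel_conjugate D (\<mu> *\<^sub>R step \<mu> u) \<le> fenchel_conjugate D (\<mu> *\<^sub>R v) +
      ereal (\<mu> * ((step \<mu> u - v) \<bullet> (inverse \<tau> *\<^sub>R (u - step \<mu> u) + A (primal u))
         + \<mu> / \<sigma>\<psi> / 2 * (norm (step \<mu> u - u))\<^sup>2))"
proof -
  define s q p where "s = step \<mu> u" and "q = grad (fenchel_conjugate \<psi>) (\<mu> *\<^sub>R u)"
    and "p = prox (\<lambda>v. ereal (inverse (\<tau> * \<mu>)) * \<phi> v) (inverse \<tau> *\<^sub>R forward \<mu> u)"
  have q: "strong_subgradient \<sigma>\<psi> \<psi> q (\<mu> *\<^sub>R u)" unfolding q_def by (rule \<psi>)
  have p: "strong_subgradient 0 \<phi> p (\<mu> *\<^sub>R s)"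
    unfolding p_def s_def step_def by (rule backward_subgradient[OF \<mu>])
  obtain a where a: "\<psi> q = ereal a"
    using q unfolding strong_subgradient_def by (metis ereal_real')
  obtain b where b: "\<phi> p = ereal b"
    using p unfolding strong_subgradient_def by (metis ereal_real')
  define e where "e = (norm (\<mu> *\<^sub>R s - \<mu> *\<^sub>R u))\<^sup>2 / (2 * \<sigma>\<psi>)"
  define B where "B = q \<bullet> (\<mu> *\<^sub>R s) - a + e + p \<bullet> (\<mu> *\<^sub>R s) - b"
  have up: "fenchel_conjugate D (\<mu> *\<^sub>R s) \<le> ereal B"
    unfolding fenchel_conjugate_def
  proof (rule SUP_least)
    fix z
    have "ereal (z \<bullet> (\<mu> *\<^sub>R s) - B) \<le> D z"
      unfolding D_def inf_convolution_def
    proof (rule INF_greatest)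
      fix x
      have "ereal (x \<bullet> (\<mu> *\<^sub>R s)) - \<psi> x \<le> ereal (q \<bullet> (\<mu> *\<^sub>R s) - a + e)"
        unfolding e_def by (rule order_trans[OF Fenchel_Young fenchel_conjugate_upper[OF q \<sigma>(2) a]])
      then have "ereal (x \<bullet> (\<mu> *\<^sub>R s) - (q \<bullet> (\<mu> *\<^sub>R s) - a + e)) \<le> \<psi> x"
        by (cases "\<psi> x") auto
      moreover have "ereal (b + (z - x - p) \<bullet> (\<mu> *\<^sub>R s)) \<le> \<phi> (z - x)"
        using p b unfolding strong_subgradient_def by (auto dest: spec[of _ "z - x"])
      ultimately have "ereal (x \<bullet> (\<mu> *\<^sub>R s) - (q \<bullet> (\<mu> *\<^sub>R s) - a + e)) + ereal (b + (z - x - p) \<bullet> (\<mu> *\<^sub>R s))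
          \<le> \<psi> x + \<phi> (z - x)" by (rule add_mono)
      moreover have "x \<bullet> (\<mu> *\<^sub>R s) - (q \<bullet> (\<mu> *\<^sub>R s) - a + e) + (b + (z - x - p) \<bullet> (\<mu> *\<^sub>R s))
          = z \<bullet> (\<mu> *\<^sub>R s) - B" unfolding B_def inner_diff_left by linarith
      ultimately show "ereal (z \<bullet> (\<mu> *\<^sub>R s) - B) \<le> \<psi> x + \<phi> (z - x)" by simp
    qed
    then show "ereal (z \<bullet> (\<mu> *\<^sub>R s)) - D z \<le> ereal B"
      by (cases "D z") auto
  qed
  then show "fenchel_conjugate D (\<mu> *\<^sub>R step \<mu> u) < \<infinity>" unfolding s_def by (auto simp: less_top[symmetric])
  have "D (q + p) \<le> \<psi> q + \<phi> (q + p - q)" unfolding D_def inf_convolution_def by (rule INF_lower) simp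
  then have "D (q + p) \<le> ereal (a + b)" using a b by simp
  then have "ereal ((q + p) \<bullet> (\<mu> *\<^sub>R v) - (a + b)) \<le> ereal ((q + p) \<bullet> (\<mu> *\<^sub>R v)) - D (q + p)"
    by (cases "D (q + p)") auto
  also have "\<dots> \<le> fenchel_conjugate D (\<mu> *\<^sub>R v)" by (rule Fenchel_Young)
  finally have lo: "ereal ((q + p) \<bullet> (\<mu> *\<^sub>R v) - (a + b)) \<le> fenchel_conjugate D (\<mu> *\<^sub>R v)" .
  have s: "s = u + \<tau> *\<^sub>R A (primal u) - \<tau> *\<^sub>R q - \<tau> *\<^sub>R p"
    unfolding s_def step_def backward_def forward_def p_def q_def by simp
  then have "u - s = \<tau> *\<^sub>R (q + p - A (primal u))" by (simp add: algebra_simps)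
  then have "inverse \<tau> *\<^sub>R (u - s) + A (primal u) = q + p" using \<tau>(1) by simp
  moreover have "e = \<mu> * (\<mu> / \<sigma>\<psi> / 2 * (norm (s - u))\<^sup>2)"
    using \<mu> by (simp add: e_def power_mult_distrib power2_eq_square mult_ac flip: scaleR_diff_right)
  ultimately have "B = (q + p) \<bullet> (\<mu> *\<^sub>R v) - (a + b) +
      (\<mu> * ((s - v) \<bullet> (inverse \<tau> *\<^sub>R (u - s) + A (primal u)) + \<mu> / \<sigma>\<psi> / 2 * (norm (s - u))\<^sup>2))"
    unfolding B_def by (simp add: inner_add_left inner_add_right inner_diff_left algebra_simps inner_commute)
  then have "ereal B = ereal ((q + p) \<bullet> (\<mu> *\<^sub>R v) - (a + b)) +
      ereal (\<mu> * ((s - v) \<bullet> (inverse \<tau> *\<^sub>R (u - s) + A (primal u)) + \<mu> / \<sigma>\<psi> / 2 * (norm (s - u))\<^sup>2))"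
    by simp
  also have "\<dots> \<le> fenchel_conjugate D (\<mu> *\<^sub>R v) +
      ereal (\<mu> * ((s - v) \<bullet> (inverse \<tau> *\<^sub>R (u - s) + A (primal u)) + \<mu> / \<sigma>\<psi> / 2 * (norm (s - u))\<^sup>2))"
    by (rule add_right_mono[OF lo])
  finally show "fenchel_conjugate D (\<mu> *\<^sub>R step \<mu> u) \<le> fenchel_conjugate D (\<mu> *\<^sub>R v) +
      ereal (\<mu> * ((step \<mu> u - v) \<bullet> (inverse \<tau> *\<^sub>R (u - step \<mu> u) + A (primal u))
         + \<mu> / \<sigma>\<psi> / 2 * (norm (step \<mu> u - u))\<^sup>2))"
    using up unfolding s_def[symmetric] by (rule order_trans[rotated])
qed

text \<open>
  The objective \<open>R*(- A* u) + D*(\<mu> u) / \<mu>\<close>; being a real number it represents the objective only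
  where the conjugate of \<open>D\<close> is finite, and 0 replaces an infinite conjugate. The lemmas below
  assume finiteness wherever an upper bound would otherwise be lost.
\<close>
definition dual :: "real \<Rightarrow> 'y \<Rightarrow> real" where
  "dual \<mu> u = smooth_dual u + real_of_ereal (fenchel_conjugate (inf_convolution \<psi> \<phi>) (\<mu> *\<^sub>R u)) / \<mu>"

text \<open>
  In the sum of \<open>smooth_dual_step\<close> and \<open>conjugate_step\<close> the terms with \<open>A (primal u)\<close> cancel, and
  the step size absorbs both quadratic remainders into \<open>\<parallel>step \<mu> u - u\<parallel>\<^sup>2 / (2\<tau>)\<close>. What is
  left is the three-point identity.
\<close>
lemma dual_step:
  assumes \<mu>: "0 < \<mu>" "\<mu> \<le> \<Lambda>"
    and D: "inf_convolution \<psi> \<phi> ybar = 0"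
    and fin: "fenchel_conjugate (inf_convolution \<psi> \<phi>) (\<mu> *\<^sub>R v) < \<infinity>"
  shows "dual \<mu> (step \<mu> u) \<le> dual \<mu> v + ((norm (u - v))\<^sup>2 - (norm (step \<mu> u - v))\<^sup>2) / (2 * \<tau>)"
proof -
  define s where "s = step \<mu> u"
  define C where "C v = fenchel_conjugate (inf_convolution \<psi> \<phi>) (\<mu> *\<^sub>R v)" for v
  have gt: "C v \<noteq> - \<infinity>" for v
    using Fenchel_Young[of ybar "\<mu> *\<^sub>R v" "inf_convolution \<psi> \<phi>"] D by (auto simp: C_def)
  obtain cv where cv: "C v = ereal cv" using fin gt[of v] by (cases "C v") (auto simp: C_def)
  obtain cs where cs: "C s = ereal cs"
    using conjugate_step(1)[OF \<mu>(1), of u] gt[of s] by (cases "C s") (auto simp: C_def s_def)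
  define g where "g = inverse \<tau> *\<^sub>R (u - s)"
  have "cs \<le> cv + \<mu> * ((s - v) \<bullet> (g + A (primal u)) + \<mu> / \<sigma>\<psi> / 2 * (norm (s - u))\<^sup>2)"
    using conjugate_step(2)[OF \<mu>(1), of u v] unfolding s_def[symmetric] g_def[symmetric]
      C_def[symmetric] by (simp add: cs cv)
  then have "cs / \<mu> \<le> cv / \<mu> + ((s - v) \<bullet> (g + A (primal u)) + \<mu> / \<sigma>\<psi> / 2 * (norm (s - u))\<^sup>2)"
    using \<mu> by (simp add: field_simps)
  moreover have "smooth_dual s \<le> smooth_dual v - A (primal u) \<bullet> (s - v) + (onorm A)\<^sup>2 / \<sigma>R / 2 * (norm (s - u))\<^sup>2"
    by (rule smooth_dual_step)
  moreover have "((onorm A)\<^sup>2 / \<sigma>R + \<mu> / \<sigma>\<psi>) / 2 * (norm (s - u))\<^sup>2 \<le> 1 / \<tau> / 2 * (norm (s - u))\<^sup>2"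
    using stepsize(1)[OF \<mu>] \<tau> by (intro mult_right_mono divide_right_mono) (auto simp: field_simps)
  ultimately have descent: "smooth_dual s + cs / \<mu> \<le> smooth_dual v + cv / \<mu> + (s - v) \<bullet> g + 1 / \<tau> / 2 * (norm (s - u))\<^sup>2"
    by (simp add: inner_add_right inner_commute distrib_right add_divide_distrib)
  have "(norm (u - v))\<^sup>2 - (norm (s - v))\<^sup>2 = 2 * ((s - v) \<bullet> (u - s)) + (norm (s - u))\<^sup>2"
    unfolding power2_norm_eq_inner
    by (simp add: inner_diff_left inner_diff_right inner_commute algebra_simps)
  moreover have "(s - v) \<bullet> g = inverse \<tau> * ((s - v) \<bullet> (u - s))" by (simp add: g_def)
  ultimately have "((norm (u - v))\<^sup>2 - (norm (s - v))\<^sup>2) / (2 * \<tau>) = (s - v) \<bullet> g + 1 / \<tau> / 2 * (norm (s - u))\<^sup>2"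
    using \<tau>(1) by (simp add: field_simps)
  with descent show ?thesis
    unfolding dual_def s_def[symmetric] C_def[symmetric] by (simp add: cv cs)
qed

text \<open>
  Here \<open>- rd\<close> is the minimum of the limiting dual objective \<open>u \<mapsto> R*(- A* u) + \<langle>ybar, u\<rangle>\<close>. The
  bound is the strong subgradient inequality of \<open>R\<close> from \<open>primal u\<close> to \<open>xdag\<close>, after discarding
  the nonnegative quantity \<open>D*(\<mu> u) / \<mu> - \<langle>ybar, u\<rangle>\<close>.
\<close>
lemma dual_gap:
  assumes D: "inf_convolution \<psi> \<phi> ybar = 0" and \<mu>: "0 < \<mu>"
    and fin: "fenchel_conjugate (inf_convolution \<psi> \<phi>) (\<mu> *\<^sub>R u) < \<infinity>"
    and xdag: "A xdag = ybar" "R xdag = ereal rd"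
  shows "\<sigma>R / 2 * (norm (primal u - xdag))\<^sup>2 \<le> dual \<mu> u + rd"
proof -
  have "ereal (ybar \<bullet> (\<mu> *\<^sub>R u)) \<le> fenchel_conjugate (inf_convolution \<psi> \<phi>) (\<mu> *\<^sub>R u)"
    using Fenchel_Young[of ybar "\<mu> *\<^sub>R u" "inf_convolution \<psi> \<phi>"] D by simp
  then have "\<mu> * (ybar \<bullet> u) \<le> real_of_ereal (fenchel_conjugate (inf_convolution \<psi> \<phi>) (\<mu> *\<^sub>R u))"
    using fin by (cases "fenchel_conjugate (inf_convolution \<psi> \<phi>) (\<mu> *\<^sub>R u)") auto
  then have 1: "ybar \<bullet> u \<le> real_of_ereal (fenchel_conjugate (inf_convolution \<psi> \<phi>) (\<mu> *\<^sub>R u)) / \<mu>"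
    using \<mu> by (simp add: field_simps)
  obtain a where a: "R (primal u) = ereal a"
    using R[of "- adjoint A u"] unfolding strong_subgradient_def primal_def by (metis ereal_real')
  have "a + ((xdag - primal u) \<bullet> (- adjoint A u) + \<sigma>R / 2 * (norm (xdag - primal u))\<^sup>2) \<le> rd"
    using R[of "- adjoint A u"] a xdag(2) unfolding strong_subgradient_def primal_def[symmetric]
    by (auto dest: spec[of _ xdag])
  moreover have "smooth_dual u = primal u \<bullet> (- adjoint A u) - a"
    using fenchel_conjugate_eq[OF R \<sigma>(1), of "- adjoint A u" a] a
    by (simp add: R_conjugate_finite primal_def)
  moreover have "xdag \<bullet> adjoint A u = ybar \<bullet> u" using inner_adjoint[OF A, of xdag u] xdag by simp
  ultimately show ?thesis
    using 1 unfolding dual_def inner_diff_left inner_minus_right norm_minus_commute[of "primal u" xdag]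
    by linarith
qed

text \<open>
  A multiplier attains the minimum \<open>- rd\<close> of the limiting dual objective, so only the excess of
  \<open>D*(\<mu> udag) / \<mu>\<close> over \<open>\<langle>ybar, udag\<rangle>\<close> remains.
\<close>
lemma dual_at_multiplier:
  assumes D: "inf_convolution \<psi> \<phi> ybar = 0" and \<mu>: "0 < \<mu>"
    and bound: "fenchel_conjugate (inf_convolution \<psi> \<phi>) (\<mu> *\<^sub>R udag) \<le> ereal (\<mu> * (ybar \<bullet> udag + \<epsilon>))"
    and xdag: "A xdag = ybar" "R xdag = ereal rd"
    and udag: "- adjoint A udag \<in> subdifferential R xdag"
  shows "dual \<mu> udag + rd \<le> \<epsilon>"
proof -
  have "ereal (ybar \<bullet> (\<mu> *\<^sub>R udag)) \<le> fenchel_conjugate (inf_convolution \<psi> \<phi>) (\<mu> *\<^sub>R udag)"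
    using Fenchel_Young[of ybar "\<mu> *\<^sub>R udag" "inf_convolution \<psi> \<phi>"] D by simp
  then have "real_of_ereal (fenchel_conjugate (inf_convolution \<psi> \<phi>) (\<mu> *\<^sub>R udag)) \<le> \<mu> * (ybar \<bullet> udag + \<epsilon>)"
    using bound by (cases "fenchel_conjugate (inf_convolution \<psi> \<phi>) (\<mu> *\<^sub>R udag)") auto
  then have 1: "real_of_ereal (fenchel_conjugate (inf_convolution \<psi> \<phi>) (\<mu> *\<^sub>R udag)) / \<mu> \<le> ybar \<bullet> udag + \<epsilon>"
    using \<mu> by (simp add: field_simps)
  have "fenchel_conjugate R (- adjoint A udag) \<le> ereal (xdag \<bullet> (- adjoint A udag) - rd)"
    unfolding fenchel_conjugate_def
  proof (rule SUP_least)
    fix x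
    have "ereal (rd + (x - xdag) \<bullet> (- adjoint A udag)) \<le> R x"
      using udag xdag(2) unfolding subdifferential_def by auto
    then show "ereal (x \<bullet> (- adjoint A udag)) - R x \<le> ereal (xdag \<bullet> (- adjoint A udag) - rd)"
      by (cases "R x") (auto simp: inner_diff_left)
  qed
  then have "smooth_dual udag \<le> - (ybar \<bullet> udag) - rd"
    using inner_adjoint[OF A, of xdag udag] xdag by (simp add: R_conjugate_finite)
  then show ?thesis using 1 by (simp add: dual_def)
qed

lemma dual_mono:
  assumes D: "inf_convolution \<psi> \<phi> ybar = 0" "\<And>y. 0 \<le> inf_convolution \<psi> \<phi> y"
    and \<mu>: "0 < \<mu>'" "\<mu>' \<le> \<mu>"
    and fin: "fenchel_conjugate (inf_convolution \<psi> \<phi>) (\<mu> *\<^sub>R u) < \<infinity>"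
  shows "dual \<mu>' u \<le> dual \<mu> u"
proof -
  define C where "C \<mu> = fenchel_conjugate (inf_convolution \<psi> \<phi>) (\<mu> *\<^sub>R u)" for \<mu>
  have gt: "C \<mu> \<noteq> - \<infinity>" for \<mu>
    using Fenchel_Young[of ybar "\<mu> *\<^sub>R u" "inf_convolution \<psi> \<phi>"] D by (auto simp: C_def)
  obtain c where c: "C \<mu> = ereal c" using fin gt[of \<mu>] by (cases "C \<mu>") (auto simp: C_def)
  have "C \<mu>' \<le> ereal (\<mu>' * (c / \<mu>))"
    using fenchel_conjugate_scale[where F = "inf_convolution \<psi> \<phi>", OF D(2) \<mu>, of u c] c
    unfolding C_def by blast
  then have "real_of_ereal (C \<mu>') \<le> \<mu>' * (c / \<mu>)" using gt[of \<mu>'] by (cases "C \<mu>'") auto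
  then have "real_of_ereal (C \<mu>') / \<mu>' \<le> c / \<mu>" using \<mu> by (simp add: field_simps)
  then show ?thesis unfolding dual_def C_def[symmetric] by (simp add: c)
qed

end

section \<open>Convergence rate for the exact datum\<close>

text \<open>
  The partial sums of \<open>e\<close> telescope to a bounded quantity, and a decreasing sequence is at most its
  averages.
\<close>
lemma decreasing_summable_rate:
  fixes e \<epsilon> b :: "nat \<Rightarrow> real"
  assumes dec: "\<And>n. e (Suc n) \<le> e n" and tele: "\<And>n. e n \<le> \<epsilon> n + b n - b (Suc n)"
    and b: "\<And>n. 0 \<le> b n" and \<epsilon>: "summable \<epsilon>" "\<And>n. 0 \<le> \<epsilon> n"
  shows "real (Suc n) * e n \<le> suminf \<epsilon> + b 0"
proof -
  have "decseq e" using dec by (rule decseq_SucI)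
  then have "(\<Sum>k<Suc n. e n) \<le> (\<Sum>k<Suc n. e k)"
    by (intro sum_mono) (auto simp: decseq_def)
  also have "\<dots> \<le> (\<Sum>k<Suc n. \<epsilon> k + (b k - b (Suc k)))"
    using tele by (intro sum_mono) (simp add: algebra_simps)
  also have "\<dots> = (\<Sum>k<Suc n. \<epsilon> k) + (b 0 - b (Suc n))"
    by (simp only: sum.distrib sum_lessThan_telescope')
  also have "\<dots> \<le> suminf \<epsilon> + b 0"
    using sum_le_suminf[OF \<epsilon>(1), of "{..<Suc n}"] \<epsilon>(2) b[of "Suc n"] by simp
  finally show ?thesis by simp
qed

context dual_forward_backward
begin

text \<open>
  The bound on the conjugate at the multiplier only holds from the index \<open>N\<close> on, since
  \<open>D*(\<lambda>\<^sub>n udag)\<close> may be infinite before; the iteration is therefore considered from \<open>N\<close> on. The gaps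
  \<open>e k\<close> decrease because a step does not increase the objective (take \<open>v = u\<close> in \<open>dual_step\<close>)
  and lowering the parameter does not either.
\<close>
lemma exact_data_rate:
  assumes D: "inf_convolution \<psi> \<phi> ybar = 0" "\<And>y. 0 \<le> inf_convolution \<psi> \<phi> y"
    and xdag: "A xdag = ybar" "\<bar>R xdag\<bar> \<noteq> \<infinity>"
    and udag: "- adjoint A udag \<in> subdifferential R xdag"
    and lam: "\<And>n. 0 < lam n" "\<And>n. lam n \<le> \<Lambda>" "\<And>n. lam (Suc n) \<le> lam n"
    and u: "\<And>n. u (Suc n) = step (lam n) (u n)"
    and bound: "\<And>n. n \<ge> N \<Longrightarrow> fenchel_conjugate (inf_convolution \<psi> \<phi>) (lam n *\<^sub>R udag)
                  \<le> ereal (lam n * (ybar \<bullet> udag + \<epsilon> n))"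
    and \<epsilon>: "summable \<epsilon>" "\<And>n. 0 \<le> \<epsilon> n"
  shows "\<exists>C N. \<forall>n\<ge>N. real n * (norm (primal (u n) - xdag))\<^sup>2 \<le> C"
proof -
  obtain rd where rd: "R xdag = ereal rd" using xdag(2) by (metis ereal_real')
  define e where "e k = dual (lam (N + k)) (u (Suc (N + k))) + rd" for k
  define b where "b k = (norm (u (N + k) - udag))\<^sup>2 / (2 * \<tau>)" for k
  have fin: "fenchel_conjugate (inf_convolution \<psi> \<phi>) (lam n *\<^sub>R u (Suc n)) < \<infinity>" for n
    unfolding u by (rule conjugate_step(1)[OF lam(1)])
  have dec: "e (Suc k) \<le> e k" for k
  proof -
    have finS: "fenchel_conjugate (inf_convolution \<psi> \<phi>) (lam (Suc (N + k)) *\<^sub>R u (Suc (N + k))) < \<infinity>"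
    proof -
      obtain c where "fenchel_conjugate (inf_convolution \<psi> \<phi>) (lam (N + k) *\<^sub>R u (Suc (N + k))) = ereal c"
        using fin[of "N + k"] Fenchel_Young[of ybar "lam (N + k) *\<^sub>R u (Suc (N + k))" "inf_convolution \<psi> \<phi>"] D(1)
        by (cases "fenchel_conjugate (inf_convolution \<psi> \<phi>) (lam (N + k) *\<^sub>R u (Suc (N + k)))") auto
      from fenchel_conjugate_scale[where F = "inf_convolution \<psi> \<phi>", OF D(2) lam(1) lam(3) this] show ?thesis
        by (rule le_less_trans) simp
    qed
    have "dual (lam (Suc (N + k))) (step (lam (Suc (N + k))) (u (Suc (N + k))))
        \<le> dual (lam (Suc (N + k))) (u (Suc (N + k)))
          + ((norm (u (Suc (N + k)) - u (Suc (N + k))))\<^sup>2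
             - (norm (step (lam (Suc (N + k))) (u (Suc (N + k))) - u (Suc (N + k))))\<^sup>2) / (2 * \<tau>)"
      by (rule dual_step[OF lam(1) lam(2) D(1) finS])
    also have "\<dots> \<le> dual (lam (Suc (N + k))) (u (Suc (N + k)))"
      using \<tau> by simp
    also have "\<dots> \<le> dual (lam (N + k)) (u (Suc (N + k)))"
      by (rule dual_mono[OF D lam(1) lam(3) fin])
    finally show ?thesis by (simp add: e_def u)
  qed
  have tele: "e k \<le> \<epsilon> (N + k) + b k - b (Suc k)" for k
  proof -
    have fd: "fenchel_conjugate (inf_convolution \<psi> \<phi>) (lam (N + k) *\<^sub>R udag) < \<infinity>"
      using bound[of "N + k"] by (rule le_less_trans) auto
    have "dual (lam (N + k)) udag + rd \<le> \<epsilon> (N + k)"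
      by (rule dual_at_multiplier[OF D(1) lam(1) bound xdag(1) rd udag]) simp
    with dual_step[OF lam(1) lam(2) D(1) fd, of "u (N + k)"]
    show ?thesis unfolding e_def b_def by (simp add: diff_divide_distrib flip: u)
  qed
  have \<epsilon>': "summable (\<lambda>k. \<epsilon> (N + k))" using \<epsilon>(1) summable_ignore_initial_segment[of \<epsilon> N] by (simp add: add.commute)
  define C where "C = suminf (\<lambda>k. \<epsilon> (N + k)) + b 0"
  have rate: "real (Suc k) * e k \<le> C" for k
    unfolding C_def
    by (rule decreasing_summable_rate[where e = e and b = b and \<epsilon> = "\<lambda>k. \<epsilon> (N + k)"])
       (use dec tele \<epsilon>' \<epsilon>(2) \<tau>(1) in \<open>auto simp: b_def\<close>)
  have "real n * (norm (primal (u n) - xdag))\<^sup>2 \<le> (real N + 1) * (2 / \<sigma>R * C)" if n: "n \<ge> Suc N" for n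
  proof -
    obtain k where k: "n = Suc (N + k)" using n by (metis Suc_le_D add_Suc le_Suc_ex)
    have gap: "\<sigma>R / 2 * (norm (primal (u n) - xdag))\<^sup>2 \<le> e k"
      unfolding e_def k by (rule dual_gap[OF D(1) lam(1) fin xdag(1) rd])
    \<comment> \<open>The gap decays in the number \<open>k + 1\<close> of steps made since \<open>N\<close>, which is comparable to \<open>n\<close>.\<close>
    have "real n \<le> (real N + 1) * real (Suc k)" by (simp add: k algebra_simps)
    then have "real n * (norm (primal (u n) - xdag))\<^sup>2 \<le> (real N + 1) * real (Suc k) * (norm (primal (u n) - xdag))\<^sup>2"
      by (rule mult_right_mono) simp
    also have "\<dots> = (real N + 1) * (2 / \<sigma>R * (real (Suc k) * (\<sigma>R / 2 * (norm (primal (u n) - xdag))\<^sup>2)))"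
      using \<sigma> by simp
    also have "\<dots> \<le> (real N + 1) * (2 / \<sigma>R * (real (Suc k) * e k))"
      using gap \<sigma> by (intro mult_left_mono) auto
    also have "\<dots> \<le> (real N + 1) * (2 / \<sigma>R * C)"
      using rate[of k] \<sigma> by (intro mult_left_mono) auto
    finally show ?thesis .
  qed
  then show ?thesis by blast
qed

section \<open>Propagation of data errors\<close>

text \<open>
  The gradient error passes through the nonexpansive backward map, and the proximal error is added
  after it.
\<close>
lemma inexact_step_error:
  assumes \<mu>: "0 < \<mu>" "\<mu> \<le> \<Lambda>"
    and gr: "norm (gr - grad (fenchel_conjugate \<psi>) (\<mu> *\<^sub>R u)) \<le> d1"
    and w: "w = u + \<tau> *\<^sub>R A (primal u) - \<tau> *\<^sub>R gr"
    and pr: "norm (pr - prox (\<lambda>v. ereal (inverse (\<tau> * \<mu>)) * \<phi> v) (inverse \<tau> *\<^sub>R w)) \<le> d2"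
  shows "norm (w - \<tau> *\<^sub>R pr - step \<mu> u) \<le> \<tau> * (d1 + d2)"
proof -
  have "w - \<tau> *\<^sub>R pr - backward \<mu> w
      = - (\<tau> *\<^sub>R (pr - prox (\<lambda>v. ereal (inverse (\<tau> * \<mu>)) * \<phi> v) (inverse \<tau> *\<^sub>R w)))"
    by (simp add: backward_def algebra_simps)
  then have "norm (w - \<tau> *\<^sub>R pr - backward \<mu> w) \<le> \<tau> * d2"
    using \<tau>(1) pr by (simp add: mult_left_mono)
  moreover have "norm (backward \<mu> w - step \<mu> u) \<le> norm (w - forward \<mu> u)"
    unfolding step_def by (rule backward_nonexpansive[OF \<mu>(1)])
  moreover have "w - forward \<mu> u = - (\<tau> *\<^sub>R (gr - grad (fenchel_conjugate \<psi>) (\<mu> *\<^sub>R u)))"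
    by (simp add: w forward_def algebra_simps)
  then have "norm (w - forward \<mu> u) \<le> \<tau> * d1"
    using \<tau>(1) gr by (simp add: mult_left_mono)
  moreover have "norm (w - \<tau> *\<^sub>R pr - step \<mu> u)
      \<le> norm (w - \<tau> *\<^sub>R pr - backward \<mu> w) + norm (backward \<mu> w - step \<mu> u)"
    using norm_triangle_ineq[of "w - \<tau> *\<^sub>R pr - backward \<mu> w" "backward \<mu> w - step \<mu> u"] by simp
  ultimately show ?thesis by (simp add: distrib_left)
qed

lemma inexact_iterates_error:
  assumes lam: "\<And>n. 0 < lam n" "\<And>n. lam n \<le> \<Lambda>"
    and u: "\<And>n. u (Suc n) = step (lam n) (u n)"
    and uh: "uh 0 = u 0" "\<And>n. norm (uh (Suc n) - step (lam n) (uh n)) \<le> d n"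
  shows "norm (uh n - u n) \<le> (\<Sum>k<n. d k)"
proof (induction n)
  case 0
  then show ?case using uh(1) by simp
next
  case (Suc n)
  have "norm (uh (Suc n) - u (Suc n))
      \<le> norm (uh (Suc n) - step (lam n) (uh n)) + norm (step (lam n) (uh n) - step (lam n) (u n))"
    unfolding u using norm_triangle_ineq[of "uh (Suc n) - step (lam n) (uh n)"
        "step (lam n) (uh n) - step (lam n) (u n)"] by simp
  also have "\<dots> \<le> d n + norm (uh n - u n)"
    by (intro add_mono uh(2) step_nonexpansive lam)
  finally show ?case using Suc by simp
qed

end

section \<open>Early stopping\<close>

text \<open>
  With \<open>b = \<beta> \<theta>\<close> the choice of \<open>t\<close> solves \<open>\<delta> t powr (1 + b) = t powr (- 1/2)\<close>, and both sides
  are \<open>\<delta> powr (1 / \<kappa>)\<close>. Rounding up costs at most a factor because \<open>c t + 1 \<le> (c + 1) t\<close>.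
\<close>
lemma stopping_index_balance:
  fixes b c \<delta> :: real
  assumes b: "b \<ge> 0" and c: "c \<ge> 1" and \<delta>: "\<delta> > 0"
  defines "\<kappa> \<equiv> 3 + 2 * b" and "t \<equiv> \<delta> powr (- 2 / (3 + 2 * b))"
  assumes t: "t \<ge> 1"
  defines "n \<equiv> nat \<lceil>c * t\<rceil>"
  shows "t \<le> real n" and "inverse (real n) \<le> (\<delta> powr (1 / \<kappa>))\<^sup>2"
    and "\<delta> * real n powr (1 + b) \<le> (c + 1) powr (1 + b) * \<delta> powr (1 / \<kappa>)"
proof -
  have \<kappa>: "\<kappa> > 0" using b by (simp add: \<kappa>_def)
  have t\<kappa>: "t = \<delta> powr (- 2 / \<kappa>)" by (simp add: t_def \<kappa>_def)
  have ct: "t \<le> c * t" using c t by simp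
  have n: "real n = of_int \<lceil>c * t\<rceil>" using ct t by (simp add: n_def)
  show tn: "t \<le> real n" using ct n by linarith
  have "real n \<le> c * t + 1" using n by linarith
  also have "\<dots> \<le> (c + 1) * t" using t by (simp add: distrib_right)
  finally have nt: "real n \<le> (c + 1) * t" .
  have "inverse (real n) \<le> inverse t" using tn t by (intro le_imp_inverse_le) auto
  also have "\<dots> = \<delta> powr (2 / \<kappa>)" using \<delta> by (simp add: t\<kappa> flip: powr_minus)
  also have "\<dots> = (\<delta> powr (1 / \<kappa>))\<^sup>2" using \<delta> by (simp add: powr_power)
  finally show "inverse (real n) \<le> (\<delta> powr (1 / \<kappa>))\<^sup>2" .
  have "real n powr (1 + b) \<le> ((c + 1) * t) powr (1 + b)" using nt b by (intro powr_mono2) auto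
  also have "\<dots> = (c + 1) powr (1 + b) * t powr (1 + b)" using c t by (simp add: powr_mult)
  finally have "\<delta> * real n powr (1 + b) \<le> \<delta> * ((c + 1) powr (1 + b) * t powr (1 + b))"
    using \<delta> by simp
  also have "\<dots> = (c + 1) powr (1 + b) * (\<delta> powr 1 * \<delta> powr (- 2 / \<kappa> * (1 + b)))"
    using \<delta> by (simp add: t\<kappa> powr_powr)
  also have "\<delta> powr 1 * \<delta> powr (- 2 / \<kappa> * (1 + b)) = \<delta> powr (1 + - 2 / \<kappa> * (1 + b))"
    by (rule powr_add[symmetric])
  also have "1 + - 2 / \<kappa> * (1 + b) = 1 / \<kappa>"
    using \<kappa> by (simp add: field_simps) (simp add: \<kappa>_def)
  finally show "\<delta> * real n powr (1 + b) \<le> (c + 1) powr (1 + b) * \<delta> powr (1 / \<kappa>)" .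
qed

theorem theorem5p7:
  fixes A :: "'x::{real_inner,complete_space} \<Rightarrow> 'y::{real_inner,complete_space}"
    and xbar xdag :: 'x and ybar u0 :: 'y
    and D J \<psi> \<phi> :: "'y \<Rightarrow> 'y \<Rightarrow> ereal"
    and R :: "'x \<Rightarrow> ereal"
    and mbar :: "real \<Rightarrow> ereal"
    and p \<sigma>\<psi> \<sigma>R \<theta> \<beta> \<tau> :: real
    and lam :: "nat \<Rightarrow> real"
  assumes A: "bounded_linear A" "A xbar = ybar"
    and AD1: "\<And>u y. 0 \<le> D u y" "\<And>u y. D u y = 0 \<longleftrightarrow> u = y"
    and AD2: "\<sigma>\<psi> > 0" "\<And>y. Gamma0 (\<phi> y)" "\<And>y. Gamma0 (J y)"
             "\<And>y. \<psi> y = (\<lambda>u. J y u + ereal (\<sigma>\<psi> / 2 * (norm u)\<^sup>2))"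
             "\<And>y. (\<lambda>u. D u y) = inf_convolution (\<psi> y) (\<phi> y)"
    and AD3: "p \<ge> 1" "coercive (\<lambda>u. D u ybar)" "well_conditioned p (\<lambda>u. D u ybar) mbar"
    and AR1: "\<sigma>R > 0" "Gamma0 R" "strongly_convex \<sigma>R R"
    and AR2: "xbar \<in> edom R"
    and xdag: "is_arg_min R (minimizer (\<lambda>x'. D (A x') ybar)) xdag"
    and qualification: "subdifferential R xdag \<inter> range (adjoint A) \<noteq> {}"
    and theta: "\<theta> > 0"
    and lam: "\<beta> > p - 1" "lam 0 > 0" "\<And>n. lam n = lam 0 / (real n + 1) powr \<beta>"
    and tau: "0 < \<tau>" "\<tau> \<le> 1 / ((onorm A)\<^sup>2 / \<sigma>R + lam 0 / \<sigma>\<psi>)"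
  shows "\<exists>t :: real \<Rightarrow> real.
           (\<exists>c1>0. \<exists>c2>0. \<forall>\<^sub>F \<delta> in at_right 0.
              c1 \<le> t \<delta> * \<delta> powr (2 / (3 + 2 * \<beta> * \<theta>)) \<and>
              t \<delta> * \<delta> powr (2 / (3 + 2 * \<beta> * \<theta>)) \<le> c2) \<and>
           (\<forall>c\<ge>1. \<exists>C. \<forall>\<^sub>F \<delta> in at_right 0.
              \<forall>yh xh wh uh.
                perturbation J \<sigma>\<psi> \<phi> \<delta> \<theta> ybar yh \<longrightarrow>
                three_D_method A R (\<psi> yh) (\<phi> yh) lam \<tau> u0 xh wh uh \<longrightarrow>
                norm (xh (nat \<lceil>c * t \<delta>\<rceil>) - xdag) \<le> C * \<delta> powr (1 / (3 + 2 * \<beta> * \<theta>)))"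
proof -
  have \<beta>: "\<beta> > 0" using lam(1) AD3(1) by simp
  have lam_pos: "0 < lam n" for n using lam(2) by (subst lam(3)) simp
  have lam_dec: "lam (Suc n) \<le> lam n" for n
    using lam(2) \<beta> by (subst (1 2) lam(3)) (auto intro!: divide_left_mono powr_mono2)
  have lam_le: "lam n \<le> lam 0" for n
    using decseq_SucI[of lam, OF lam_dec] by (simp add: decseq_def)
  have lam_lim: "lam \<longlonglongrightarrow> 0"
  proof -
    have "filterlim (\<lambda>n. real (Suc n)) at_top sequentially"
      by (rule filterlim_compose[OF filterlim_real_sequentially filterlim_Suc])
    then have "(\<lambda>n. lam 0 * real (Suc n) powr (- \<beta>)) \<longlonglongrightarrow> lam 0 * 0"
      using \<beta> by (intro tendsto_mult tendsto_const tendsto_neg_powr) auto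
    moreover have "(\<lambda>n. lam 0 * real (Suc n) powr (- \<beta>)) = lam"
    proof
      fix n show "lam 0 * real (Suc n) powr (- \<beta>) = lam n"
        by (subst lam(3)[of n]) (simp add: powr_minus divide_inverse add.commute)
    qed
    ultimately show ?thesis by (simp only: mult_zero_right)
  qed

  have \<psi>_sub: "strong_subgradient \<sigma>\<psi> (\<psi> y) (grad (fenchel_conjugate (\<psi> y)) v) v"
    and \<psi>_prox: "grad (fenchel_conjugate (\<psi> y)) v
      = prox (\<lambda>v. J y v / ereal \<sigma>\<psi>) (inverse \<sigma>\<psi> *\<^sub>R v)" for y v
    unfolding AD2(4) by (rule grad_fenchel_conjugate_prox[OF AD2(3,1)])+
  have R_sub: "strong_subgradient \<sigma>R R (grad (fenchel_conjugate R) v) v" for v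
  proof -
    obtain q where q: "strong_subgradient \<sigma>R R q v"
      using strongly_convex_subgradient[OF AR1(3,1)] by blast
    show ?thesis unfolding grad_fenchel_conjugate[OF q AR1(1)] by (rule q)
  qed
  interpret exact: dual_forward_backward A R "\<psi> ybar" "\<phi> ybar" \<sigma>R \<sigma>\<psi> \<tau> "lam 0"
    by (rule dual_forward_backward.intro) (fact A(1) AR1(1) AD2(1) R_sub \<psi>_sub AD2(2) tau lam(2))+

  have D: "inf_convolution (\<psi> ybar) (\<phi> ybar) = (\<lambda>u. D u ybar)" by (rule AD2(5)[symmetric])
  have D0: "inf_convolution (\<psi> ybar) (\<phi> ybar) ybar = 0" unfolding D by (simp add: AD1(2))
  have Dge: "0 \<le> inf_convolution (\<psi> ybar) (\<phi> ybar) y" for y unfolding D by (rule AD1(1))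

  \<comment> \<open>Since \<open>xbar\<close> is feasible with \<open>D = 0\<close>, the minimizers of the data term are the solutions of
    \<open>A x = ybar\<close>; comparison with \<open>xbar\<close> also gives finiteness of \<open>R xdag\<close>.\<close>
  have "minimizer (\<lambda>x. D (A x) ybar) xdag" using xdag by (simp add: is_arg_min_def)
  then have "\<not> D (A xbar) ybar < D (A xdag) ybar" by (simp add: minimizer_def is_arg_min_def)
  moreover have "D (A xbar) ybar = 0" by (simp add: A(2) AD1(2))
  ultimately have "D (A xdag) ybar = 0" using AD1(1)[of "A xdag" ybar] by simp
  then have Axdag: "A xdag = ybar" by (simp add: AD1(2))
  have "minimizer (\<lambda>x. D (A x) ybar) xbar"
    using AD1(1) \<open>D (A xbar) ybar = 0\<close> by (simp add: minimizer_def is_arg_min_def not_less)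
  then have "R xdag \<le> R xbar" using xdag by (auto simp: is_arg_min_def not_less)
  then have "R xdag < \<infinity>" using AR2 by (auto simp: edom_def)
  moreover have "R xdag \<noteq> - \<infinity>" using AR1(2) by (simp add: Gamma0_def)
  ultimately have Rfin: "\<bar>R xdag\<bar> \<noteq> \<infinity>" by auto

  obtain v where v: "adjoint A v \<in> subdifferential R xdag" using qualification by blast
  \<comment> \<open>The dual variable enters as \<open>- A* u\<close>, which explains the sign.\<close>
  define udag where "udag = - v"
  have udag: "- adjoint A udag \<in> subdifferential R xdag"
    using v by (simp add: udag_def adjoint_minus[OF A(1)])

  have "minimizer (\<lambda>u. D u ybar) ybar" "D ybar ybar = 0"
    using AD1 by (auto simp: minimizer_def is_arg_min_def not_less AD1(2)[THEN iffD2])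
  then obtain G g where G: "G > 0" and g: "g > 0"
    and conj: "\<forall>v. norm v \<le> G \<longrightarrow> fenchel_conjugate (\<lambda>u. D u ybar) v
       \<le> ereal (ybar \<bullet> v + (if p = 1 then 0 else norm v * (norm v / g) powr (1 / (p - 1))))"
    by (rule well_conditioned_conjugate[OF AD3(3) _ _ AD3(1)])
  define \<epsilon> where "\<epsilon> = (\<lambda>n. if p = 1 then 0
    else norm udag * (lam n * norm udag / g) powr (1 / (p - 1)))"
  have \<epsilon>0: "0 \<le> \<epsilon> n" for n by (simp add: \<epsilon>_def)
  have \<epsilon>: "summable \<epsilon>"
  proof (cases "p = 1")
    case False
    then have "summable (\<lambda>n. norm udag * (lam n * norm udag / g) powr (1 / (p - 1)))"
      using AD3(1) g
      by (intro summable_conditioning_error[OF lam(3) lam(2) _ lam(1)]) simp_all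
    then show ?thesis using False unfolding \<epsilon>_def by (simp only: if_False)
  qed (simp add: \<epsilon>_def)
  have "(\<lambda>n. lam n * norm udag) \<longlonglongrightarrow> 0 * norm udag" by (intro tendsto_intros lam_lim)
  then have "\<forall>\<^sub>F n in sequentially. lam n * norm udag < G" using G by (simp add: order_tendstoD(2))
  then obtain N where N: "\<And>n. n \<ge> N \<Longrightarrow> lam n * norm udag \<le> G"
    unfolding eventually_sequentially by (blast intro: less_imp_le)
  have bound: "fenchel_conjugate (inf_convolution (\<psi> ybar) (\<phi> ybar)) (lam n *\<^sub>R udag)
      \<le> ereal (lam n * (ybar \<bullet> udag + \<epsilon> n))" if "n \<ge> N" for n
    using conj[rule_format, of "lam n *\<^sub>R udag"] N[OF that] lam_pos[of n]
    unfolding D \<epsilon>_def by (simp add: distrib_left mult_ac split: if_splits)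

  \<comment> \<open>The run of the method on the exact datum.\<close>
  define u where "u = rec_nat u0 (\<lambda>n. exact.step (lam n))"
  have u: "u 0 = u0" "\<And>n. u (Suc n) = exact.step (lam n) (u n)" by (simp_all add: u_def)
  obtain C1 N1 where rate: "\<forall>n\<ge>N1. real n * (norm (exact.primal (u n) - xdag))\<^sup>2 \<le> C1"
    using exact.exact_data_rate[OF D0 Dge Axdag Rfin udag lam_pos lam_le lam_dec u(2) bound \<epsilon> \<epsilon>0] by blast

  define b where "b = \<beta> * \<theta>"
  have b: "b \<ge> 0" using \<beta> theta by (simp add: b_def)
  define M where "M = 1 + (1 / (\<tau> * lam 0)) powr \<theta>"
  have M: "M \<ge> 0" by (simp add: M_def add_nonneg_nonneg)
  have noise: "norm (uh n - u n) \<le> \<tau> * M * (\<delta> * real n powr (1 + b))"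
    if pert: "perturbation J \<sigma>\<psi> \<phi> \<delta> \<theta> ybar yh"
      and meth: "three_D_method A R (\<psi> yh) (\<phi> yh) lam \<tau> u0 xh wh uh"
      and \<delta>: "\<delta> > 0" for yh xh wh uh \<delta> n
  proof -
    define d where "d k = \<tau> * (\<delta> + inverse (\<tau> * lam k) powr \<theta> * \<delta>)" for k
    have J: "norm (prox (\<lambda>v. J ybar v / ereal \<sigma>\<psi>) z - prox (\<lambda>v. J yh v / ereal \<sigma>\<psi>) z) \<le> \<delta>" for z
      using pert unfolding perturbation_def SUP_le_iff by simp
    have \<phi>: "norm (prox (\<lambda>v. ereal \<alpha> * \<phi> ybar v) z - prox (\<lambda>v. ereal \<alpha> * \<phi> yh v) z) \<le> \<alpha> powr \<theta> * \<delta>"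
      if "\<alpha> > 0" for \<alpha> z
      using pert that unfolding perturbation_def SUP_le_iff by simp
    have uh0: "uh 0 = u 0" using meth by (simp add: three_D_method_def u)
    have step: "norm (uh (Suc k) - exact.step (lam k) (uh k)) \<le> d k" for k
    proof -
      define gr where "gr = grad (fenchel_conjugate (\<psi> yh)) (lam k *\<^sub>R uh k)"
      define pr where "pr = prox (\<lambda>v. ereal (inverse (\<tau> * lam k)) * \<phi> yh v) (inverse \<tau> *\<^sub>R wh (Suc k))"
      have w: "wh (Suc k) = uh k + \<tau> *\<^sub>R A (exact.primal (uh k)) - \<tau> *\<^sub>R gr"
        and uS: "uh (Suc k) = wh (Suc k) - \<tau> *\<^sub>R pr"
        using meth by (simp_all add: three_D_method_def exact.primal_def gr_def pr_def)
      show ?thesis unfolding uS d_def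
      proof (rule exact.inexact_step_error[OF lam_pos lam_le _ w])
        show "norm (gr - grad (fenchel_conjugate (\<psi> ybar)) (lam k *\<^sub>R uh k)) \<le> \<delta>"
          unfolding gr_def \<psi>_prox using J by (simp add: norm_minus_commute)
        show "norm (pr - prox (\<lambda>v. ereal (inverse (\<tau> * lam k)) * \<phi> ybar v) (inverse \<tau> *\<^sub>R wh (Suc k)))
            \<le> inverse (\<tau> * lam k) powr \<theta> * \<delta>"
          unfolding pr_def using \<phi>[of "inverse (\<tau> * lam k)"] tau(1) lam_pos[of k]
          by (simp add: norm_minus_commute)
      qed
    qed
    \<comment> \<open>The errors grow with \<open>k\<close>, so bounding each by the last one loses only a constant factor.\<close>
    have d: "d k \<le> \<tau> * \<delta> * M * real n powr b" if k: "k < n" for k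
    proof -
      have "inverse (\<tau> * lam k) = 1 / (\<tau> * lam 0) * (real k + 1) powr \<beta>"
        by (subst lam(3)) (simp add: divide_inverse mult_ac)
      also have "\<dots> powr \<theta> = (1 / (\<tau> * lam 0)) powr \<theta> * (real k + 1) powr b"
        by (subst powr_mult) (simp_all add: powr_powr b_def)
      also have "\<dots> \<le> (1 / (\<tau> * lam 0)) powr \<theta> * real n powr b"
        using k b by (intro mult_left_mono powr_mono2) auto
      finally have "inverse (\<tau> * lam k) powr \<theta> \<le> (1 / (\<tau> * lam 0)) powr \<theta> * real n powr b" .
      moreover have "1 \<le> real n powr b" using k b by (intro ge_one_powr_ge_zero) auto
      ultimately have "1 + inverse (\<tau> * lam k) powr \<theta> \<le> M * real n powr b"
        by (simp add: M_def distrib_right)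
      then have "\<tau> * \<delta> * (1 + inverse (\<tau> * lam k) powr \<theta>) \<le> \<tau> * \<delta> * (M * real n powr b)"
        using tau(1) \<delta> by (intro mult_left_mono) auto
      then show ?thesis by (simp add: d_def algebra_simps)
    qed
    have "norm (uh n - u n) \<le> (\<Sum>k<n. d k)"
      by (rule exact.inexact_iterates_error[OF lam_pos lam_le u(2) uh0 step])
    also have "\<dots> \<le> (\<Sum>k<n. \<tau> * \<delta> * M * real n powr b)" using d by (intro sum_mono) auto
    also have "\<dots> = \<tau> * M * (\<delta> * (real n * real n powr b))" by (simp add: mult_ac)
    also have "real n * real n powr b = real n powr (1 + b)" by (simp add: powr_add)
    finally show ?thesis .
  qed

  define \<kappa> where "\<kappa> = 3 + 2 * \<beta> * \<theta>"
  have \<kappa>b: "\<kappa> = 3 + 2 * b" by (simp add: \<kappa>_def b_def)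
  have \<kappa>: "\<kappa> > 0" using b by (simp add: \<kappa>b)
  define t where "t \<delta> = \<delta> powr (- 2 / \<kappa>)" for \<delta> :: real
  have pos: "\<forall>\<^sub>F \<delta> in at_right 0. (0::real) < \<delta>" by (rule eventually_at_right_less)
  have "1 \<le> t \<delta> * \<delta> powr (2 / \<kappa>) \<and> t \<delta> * \<delta> powr (2 / \<kappa>) \<le> 1" if "\<delta> > 0" for \<delta>
    using that by (simp add: t_def flip: powr_add)
  then have part1: "\<forall>\<^sub>F \<delta> in at_right 0. 1 \<le> t \<delta> * \<delta> powr (2 / \<kappa>) \<and> t \<delta> * \<delta> powr (2 / \<kappa>) \<le> 1"
    using pos by (auto elim: eventually_mono)
  have large: "\<forall>\<^sub>F \<delta> in at_right 0. real (Suc N1) \<le> t \<delta>"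
  proof (rule eventually_at_rightI)
    show "(0::real) < real (Suc N1) powr (- \<kappa> / 2)" by simp
    fix \<delta> assume \<delta>: "\<delta> \<in> {0<..<real (Suc N1) powr (- \<kappa> / 2)}"
    have "real (Suc N1) = (real (Suc N1) powr (- \<kappa> / 2)) powr (- 2 / \<kappa>)"
      unfolding powr_powr using \<kappa> by simp
    also have "\<dots> \<le> t \<delta>" unfolding t_def using \<delta> \<kappa> by (intro powr_mono2') auto
    finally show "real (Suc N1) \<le> t \<delta>" .
  qed
  have part2: "\<exists>C. \<forall>\<^sub>F \<delta> in at_right 0. \<forall>yh xh wh uh.
      perturbation J \<sigma>\<psi> \<phi> \<delta> \<theta> ybar yh \<longrightarrow>
      three_D_method A R (\<psi> yh) (\<phi> yh) lam \<tau> u0 xh wh uh \<longrightarrow>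
      norm (xh (nat \<lceil>c * t \<delta>\<rceil>) - xdag) \<le> C * \<delta> powr (1 / \<kappa>)" if c: "c \<ge> 1" for c
  proof -
    define K where "K = onorm A / \<sigma>R * (\<tau> * M)"
    have K: "K \<ge> 0" using onorm_pos_le[OF A(1)] AR1(1) tau(1) M by (simp add: K_def)
    define C where "C = K * (c + 1) powr (1 + b) + sqrt \<bar>C1\<bar>"
    have "\<forall>\<^sub>F \<delta> in at_right 0. \<forall>yh xh wh uh.
      perturbation J \<sigma>\<psi> \<phi> \<delta> \<theta> ybar yh \<longrightarrow>
      three_D_method A R (\<psi> yh) (\<phi> yh) lam \<tau> u0 xh wh uh \<longrightarrow>
      norm (xh (nat \<lceil>c * t \<delta>\<rceil>) - xdag) \<le> C * \<delta> powr (1 / \<kappa>)"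
      using pos large
    proof eventually_elim
      case (elim \<delta>)
      define n s where "n = nat \<lceil>c * t \<delta>\<rceil>" and "s = \<delta> powr (1 / \<kappa>)"
      have t1: "1 \<le> t \<delta>" using elim(2) by simp
      note balance = stopping_index_balance[OF b c elim(1), folded \<kappa>b, folded t_def, OF t1,
          folded n_def s_def]
      have "N1 \<le> n" "0 < real n" using balance(1) elim(2) by linarith+
      show ?case unfolding n_def[symmetric] s_def[symmetric]
      proof (intro allI impI)
        fix yh xh wh uh
        assume pert: "perturbation J \<sigma>\<psi> \<phi> \<delta> \<theta> ybar yh"
          and meth: "three_D_method A R (\<psi> yh) (\<phi> yh) lam \<tau> u0 xh wh uh"
        have "xh n = exact.primal (uh n)" using meth by (simp add: three_D_method_def exact.primal_def)
        then have "norm (xh n - exact.primal (u n)) \<le> onorm A / \<sigma>R * norm (uh n - u n)"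
          using exact.primal_Lipschitz by simp
        also have "\<dots> \<le> onorm A / \<sigma>R * (\<tau> * M * (\<delta> * real n powr (1 + b)))"
          using onorm_pos_le[OF A(1)] AR1(1) noise[OF pert meth elim(1)] by (intro mult_left_mono) auto
        also have "\<dots> = K * (\<delta> * real n powr (1 + b))" by (simp add: K_def)
        also have "\<dots> \<le> K * ((c + 1) powr (1 + b) * s)" by (rule mult_left_mono[OF balance(3) K])
        finally have 1: "norm (xh n - exact.primal (u n)) \<le> K * (c + 1) powr (1 + b) * s" by simp
        have "real n * (norm (exact.primal (u n) - xdag))\<^sup>2 \<le> \<bar>C1\<bar>"
          using rate \<open>N1 \<le> n\<close> by fastforce
        then have "(norm (exact.primal (u n) - xdag))\<^sup>2 \<le> \<bar>C1\<bar> * inverse (real n)"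
          using \<open>0 < real n\<close> by (simp add: field_simps)
        also have "\<dots> \<le> \<bar>C1\<bar> * s\<^sup>2" by (rule mult_left_mono[OF balance(2)]) simp
        also have "\<dots> = (sqrt \<bar>C1\<bar> * s)\<^sup>2" by (simp add: power_mult_distrib)
        finally have "norm (exact.primal (u n) - xdag) \<le> sqrt \<bar>C1\<bar> * s"
          by (rule power2_le_imp_le) (simp add: s_def)
        with 1 have "norm (xh n - exact.primal (u n)) + norm (exact.primal (u n) - xdag) \<le> C * s"
          by (simp add: C_def distrib_right)
        then show "norm (xh n - xdag) \<le> C * s"
          using norm_triangle_ineq[of "xh n - exact.primal (u n)" "exact.primal (u n) - xdag"] by simp
      qed
    qed
    then show ?thesis by blast
  qed
  show ?thesis
    unfolding \<kappa>_def[symmetric]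
    by (intro exI[of _ t] conjI exI[of _ 1] allI impI part1 part2) simp_all
qed

end
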